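(* Let $k_1,k_2>0$, $\rho=k_1+2k_2$, and let $\phi_\lambda(e^t)$ ($\lambda\geq0$, $t\geq 0$) be the Weyl-invariant hypergeometric (spherical) function for the root system $BC_1$ with multiplicities $k_1=k(\alpha)$, $k_2=k(2\alpha)$. Then there exist constants $C_1,C_2>0$ (depending only on $k_1,k_2$) such that for all $\lambda\geq 0$ and $t\geq 0$, $$C_1\,B(\lambda,t)\leq\phi_\lambda(e^t)\leq C_2\,B(\lambda,t),\qquad B(\lambda,t)=e^{(\lambda-\rho)t}\,\frac{1+t}{(1+\lambda t)^{k_1+k_2}}\left(\frac{1+\lambda(1+t)}{1+\lambda}\right)^{k_1+k_2-1}.$$
   Context: The hypergeometric function for $BC_1$ with multiplicities $k_1=k(\alpha)$, $k_2=k(2\alpha)$ is $$\phi_\lambda(e^t)={}_2F_1\left(\frac{\rho+\lambda}{2},\frac{\rho-\lambda}{2};k_1+k_2+\frac12;-\sinh^2 t\right),$$ where $\rho=k_1+2k_2$ and ${}_2F_1(a,b;c;z)$ is the Gauss hypergeometric function, analytically continued to $\mathbf{C}\setminus[1,\infty)$. Equivalently, $$\phi_\lambda(e^t)=\frac{2\,\Gamma(k_1+k_2+1/2)}{\Gamma(1/2)\Gamma(k_1)\Gamma(k_2)}\int_0^1\int_0^\pi|\cosh t+r e^{i\phi}\sinh t|^{\lambda-\rho}(1-r^2)^{k_1-1}r^{2k_2-1}\sin^{2k_2-1}\phi\; r\,d\phi\,dr.$$ *)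

theory Defs
  imports "HOL-Complex_Analysis.Complex_Analysis"
begin

definition slit_plane :: "complex set" where
  "slit_plane = - complex_of_real ` {1..}"

(* The Gauss hypergeometric function 2F1(a,b;c;z), c not in {0,-1,-2,...}, as the analytic
   continuation to the slit plane of its power series on the unit disc.  The slit plane is
   connected, so the continuation is unique there; off the slit plane the value is arbitrary. *)
definition hyp2F1 :: "complex \<Rightarrow> complex \<Rightarrow> complex \<Rightarrow> complex \<Rightarrow> complex" where
  "hyp2F1 a b c = (SOME F. F holomorphic_on slit_plane \<and>
     (\<forall>z\<in>ball 0 1. F z = eval_fps (fps_hypergeo [a, b] [c] 1) z))"

definition BC1_rho :: "real \<Rightarrow> real \<Rightarrow> real" where
  "BC1_rho k1 k2 = k1 + 2 * k2"

(* BC1_phi k1 k2 l t is the value of phi_l at the group element e^t. *)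
definition BC1_phi :: "real \<Rightarrow> real \<Rightarrow> complex \<Rightarrow> real \<Rightarrow> complex" where
  "BC1_phi k1 k2 l t =
     hyp2F1 ((of_real (BC1_rho k1 k2) + l) / 2) ((of_real (BC1_rho k1 k2) - l) / 2)
       (of_real (k1 + k2 + 1 / 2)) (of_real (- (sinh t)\<^sup>2))"

definition BC1_bound :: "real \<Rightarrow> real \<Rightarrow> real \<Rightarrow> real \<Rightarrow> real" where
  "BC1_bound k1 k2 l t =
     exp ((l - BC1_rho k1 k2) * t) * ((1 + t) / (1 + l * t) powr (k1 + k2)) *
     ((1 + l * (1 + t)) / (1 + l)) powr (k1 + k2 - 1)"

end

theory Submission
  imports Defs
begin

text \<open>
  Put \<open>K = k1 + k2\<close> and \<open>x = tanh t\<close>. Pfaff's transformation turns \<open>\<phi>\<close> into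
  \<open>(cosh t) powr - (\<rho> + \<lambda>)\<close> times a power series in \<open>x\<^sup>2\<close> with positive coefficients
  \<open>(a)_n (a')_n / ((c)_n n!)\<close>. Two products \<open>(p)_n (q)_n\<close> and \<open>(r)_n (s)_n\<close> with \<open>p + q = r + s\<close>
  differ by a bounded factor, uniformly in a common shift of the parameters, so up to constants
  the series is the even part of \<open>f(x) = 2F1(K + \<lambda>, 1; K + 1; x)\<close>, and hence \<open>f(x)\<close> itself
  because \<open>0 \<le> f(-x) \<le> f(x)\<close>. The function \<open>f\<close> solves a first-order equation: with
  \<open>x = 1 - exp (- s)\<close>, the derivative of \<open>x^K exp (- \<lambda> s) f(x)\<close> in \<open>s\<close> is
  \<open>K (1 - exp (- s))^(K - 1) exp (- \<lambda> s)\<close>. Comparing derivatives shows that this function is of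
  the size of \<open>m^K (1 + m)^(1 - K)\<close> at \<open>m = s / (1 + \<lambda> s)\<close>, the point where the exponential
  factor cuts off the integral. Finally \<open>s = t + ln (cosh t)\<close> lies between \<open>t\<close> and \<open>2 t\<close>.
\<close>

unbundle no vec_syntax

section \<open>Continuation of the Gauss series\<close>

text \<open>This is the predicate under the choice operator of \<open>hyp2F1\<close>. Once it has a
  witness, \<open>hyp2F1 a b c\<close> satisfies it, and the later results are proved for any
  \<open>F\<close> that does.\<close>

definition hypergeo_continuation ::
  "complex \<Rightarrow> complex \<Rightarrow> complex \<Rightarrow> (complex \<Rightarrow> complex) \<Rightarrow> bool" where
  "hypergeo_continuation a b c F \<longleftrightarrow> F holomorphic_on slit_plane \<and>
     (\<forall>z\<in>ball 0 1. F z = eval_fps (fps_hypergeo [a, b] [c] 1) z)"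

section \<open>Convergence of the Gauss series on the unit disc\<close>

lemma shift_ratio_tendsto_1:
  fixes a c :: "'a :: real_normed_field"
  shows "(\<lambda>n. (a + of_nat n) / (c + of_nat n)) \<longlonglongrightarrow> 1"
proof -
  have inf: "filterlim (\<lambda>n. c + of_nat n) at_infinity sequentially"
    by (intro tendsto_add_filterlim_at_infinity[OF tendsto_const] tendsto_of_nat)
  have ne: "eventually (\<lambda>n. c + of_nat n \<noteq> 0) sequentially"
    using filterlim_at_infinity_imp_eventually_ne[OF inf, of 0] .
  have "(\<lambda>n. 1 + (a - c) / (c + of_nat n)) \<longlonglongrightarrow> 1 + 0"
    by (intro tendsto_add tendsto_const tendsto_divide_0[OF tendsto_const inf])
  moreover have "eventually (\<lambda>n. 1 + (a - c) / (c + of_nat n) = (a + of_nat n) / (c + of_nat n)) sequentially"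
    using ne by eventually_elim (simp add: field_simps)
  ultimately show ?thesis
    using filterlim_cong[OF refl refl] by (simp add: tendsto_cong)
qed

text \<open>Ratio test: the quotient of consecutive coefficients is a rational function of
  \<open>n\<close> with limit 1. Only an inequality is claimed, since the series terminates when
  \<open>a\<close> or \<open>b\<close> is a nonpositive integer.\<close>

lemma fps_conv_radius_hypergeo:
  fixes a b c :: "'a :: {banach, real_normed_field}"
  shows "fps_conv_radius (fps_hypergeo [a, b] [c] 1) \<ge> 1"
  unfolding fps_conv_radius_def
proof (rule conv_radius_geI_ex')
  let ?f = "fps_nth (fps_hypergeo [a, b] [c] 1)"
  fix r :: real assume r: "0 < r" "ereal r < 1"
  define q where "q = (1 + r) / 2"
  have q: "r < q" "q < 1" using r by (auto simp: q_def)
  have "(\<lambda>n. norm (((a + of_nat n) / (c + of_nat n)) * ((b + of_nat n) / (1 + of_nat n))) * r)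
      \<longlonglongrightarrow> norm (1 * 1 :: 'a) * r"
    by (intro tendsto_intros shift_ratio_tendsto_1)
  hence "eventually (\<lambda>n. norm (((a + of_nat n) / (c + of_nat n)) * ((b + of_nat n) / (1 + of_nat n))) * r < q) sequentially"
    using q by (intro order_tendstoD(2)) auto
  then obtain N where N: "\<And>n. n \<ge> N \<Longrightarrow>
      norm (((a + of_nat n) / (c + of_nat n)) * ((b + of_nat n) / (1 + of_nat n))) * r < q"
    by (auto simp: eventually_sequentially)
  show "summable (\<lambda>n. ?f n * of_real r ^ n)"
  proof (rule summable_ratio_test[of q N])
    fix n assume n: "n \<ge> N"
    have "?f (Suc n) = (((a + of_nat n) / (c + of_nat n)) * ((b + of_nat n) / (1 + of_nat n))) * ?f n"
      by (simp add: fps_hypergeo_rec del: fps_hypergeo_nth)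
    hence "norm (?f (Suc n) * of_real r ^ Suc n) =
        (norm (((a + of_nat n) / (c + of_nat n)) * ((b + of_nat n) / (1 + of_nat n))) * r) *
        norm (?f n * of_real r ^ n)"
      using r by (simp add: norm_mult norm_power norm_divide mult_ac del: fps_hypergeo_nth)
    also have "\<dots> \<le> q * norm (?f n * of_real r ^ n)"
      by (intro mult_right_mono less_imp_le[OF N[OF n]]) auto
    finally show "norm (?f (Suc n) * of_real r ^ Suc n) \<le> q * norm (?f n * of_real r ^ n)" .
  qed (use q in auto)
qed

lemma norm_less_conv_radius_hypergeo:
  "norm (z :: 'a) < 1 \<Longrightarrow>
    ereal (norm z) < fps_conv_radius (fps_hypergeo [a, b] [c] (1 :: 'a :: {banach, real_normed_field}))"
  using fps_conv_radius_hypergeo[of a b c] by (metis ereal_less(3) less_le_trans)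

lemma open_slit_plane: "open slit_plane"
proof -
  have "closed (complex_of_real ` {1..})"
    by (intro closed_injective_linear_image) (auto simp: inj_def linear_iff scaleR_conv_of_real)
  thus ?thesis by (auto simp: slit_plane_def)
qed

lemma ball_subset_slit_plane: "ball 0 1 \<subseteq> slit_plane"
  by (auto simp: slit_plane_def)

section \<open>Contiguous relations for continuations\<close>

lemma hypergeo_continuation_deriv:
  assumes "hypergeo_continuation a b c F" "norm z < 1"
  shows "deriv F z = eval_fps (fps_deriv (fps_hypergeo [a, b] [c] 1)) z"
proof -
  have "eval_fps (fps_deriv (fps_hypergeo [a, b] [c] 1)) z = deriv (eval_fps (fps_hypergeo [a, b] [c] 1)) z"
    using assms by (intro eval_fps_deriv norm_less_conv_radius_hypergeo)
  also have "\<dots> = deriv F z"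
    using assms by (intro deriv_cong_ev eventually_mono[OF eventually_nhds_in_open[of "ball 0 1"]])
      (auto simp: hypergeo_continuation_def)
  finally show ?thesis ..
qed

text \<open>Since \<open>pochhammer (c + 1) n = pochhammer c n * (c + n) / c\<close>, the operator
  \<open>1 + (z / c) d/dz\<close> multiplies the coefficients of the series for \<open>c + 1\<close>
  by \<open>(c + n) / c\<close> and so produces the series for \<open>c\<close>. It preserves
  holomorphy on the slit plane, hence it also carries continuations to continuations.\<close>

lemma hypergeo_continuation_lower_c:
  assumes F: "hypergeo_continuation a b (c + 1) F" and c: "c \<notin> \<int>\<^sub>\<le>\<^sub>0"
  shows "hypergeo_continuation a b c (\<lambda>z. F z + z * deriv F z / c)"
proof -
  let ?f = "fps_hypergeo [a, b] [c + 1] 1"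
  have c0: "c \<noteq> 0" using c by auto
  have "c + of_nat n \<noteq> 0" for n
    using c by (metis add_eq_0_iff2 minus_of_nat_in_nonpos_Ints)
  moreover from this[of "Suc _"] have "c + 1 + of_nat n \<noteq> 0" for n
    by (simp add: add_ac)
  ultimately have nz: "pochhammer c n \<noteq> 0" "pochhammer (c + 1) n \<noteq> 0" "c + of_nat n \<noteq> 0" for n
    by (auto simp: pochhammer_eq_0_iff add_eq_0_iff2)
  have rec: "pochhammer (c + 1) n = pochhammer c n * (c + of_nat n) / c" for n
    using pochhammer_rec[of c n] pochhammer_Suc[of c n] c0 by (simp add: field_simps)
  have eq: "fps_hypergeo [a, b] [c] 1 = ?f + fps_const (1 / c) * (fps_X * fps_deriv ?f)"
  proof (rule fps_ext)
    fix n show "fps_hypergeo [a, b] [c] 1 $ n = (?f + fps_const (1 / c) * (fps_X * fps_deriv ?f)) $ n"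
    proof (cases n)
      case (Suc m)
      have "fps_hypergeo [a, b] [c] 1 $ n = (c + of_nat n) / c * ?f $ n"
        using nz[of n] c0 by (simp add: rec)
      also have "(c + of_nat n) / c = 1 + of_nat n / c"
        using c0 by (simp add: field_simps)
      finally have "fps_hypergeo [a, b] [c] 1 $ n = (1 + of_nat n / c) * ?f $ n" .
      thus ?thesis by (simp add: Suc algebra_simps del: fps_hypergeo_nth of_nat_Suc)
    qed (simp add: rec)
  qed
  show ?thesis
    unfolding hypergeo_continuation_def
  proof (intro conjI ballI)
    show "(\<lambda>z. F z + z * deriv F z / c) holomorphic_on slit_plane"
      using F c0 open_slit_plane by (auto simp: hypergeo_continuation_def intro!: holomorphic_intros)
  next
    fix z :: complex assume "z \<in> ball 0 1"
    hence z: "norm z < 1" by simp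
    note r = norm_less_conv_radius_hypergeo[OF z, of a b "c + 1"]
    have r': "ereal (norm z) < fps_conv_radius (fps_deriv ?f)"
      using r fps_conv_radius_deriv[of ?f] by order
    have r'': "ereal (norm z) < fps_conv_radius (fps_X * fps_deriv ?f)"
      using r' fps_conv_radius_mult[of fps_X "fps_deriv ?f"] by (simp add: min_def split: if_splits)
    have r3: "ereal (norm z) < fps_conv_radius (fps_const (1 / c) * (fps_X * fps_deriv ?f))"
      using r'' c0 by (subst fps_conv_radius_cmult_left) auto
    have "eval_fps (fps_hypergeo [a, b] [c] 1) z = eval_fps ?f z + (1 / c) * (z * eval_fps (fps_deriv ?f) z)"
      unfolding eq using r r' r'' r3 by (simp add: eval_fps_add eval_fps_mult)
    also have "\<dots> = F z + z * deriv F z / c"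
      using F z by (simp add: hypergeo_continuation_deriv[OF F z] hypergeo_continuation_def)
    finally show "F z + z * deriv F z / c = eval_fps (fps_hypergeo [a, b] [c] 1) z" ..
  qed
qed

text \<open>Here too a first-order differential operator, holomorphic on the whole slit plane,
  lowers the parameter; the contiguous relation behind it is checked on coefficients.\<close>

lemma hypergeo_continuation_lower_b:
  assumes F: "hypergeo_continuation a (b + 1) c F" and c: "c \<notin> \<int>\<^sub>\<le>\<^sub>0" and bc: "c - b - 1 \<noteq> 0"
  shows "hypergeo_continuation a b c
    (\<lambda>z. (z * (1 - z) * deriv F z + (c - b - 1 - a * z) * F z) / (c - b - 1))"
proof -
  let ?f = "fps_hypergeo [a, b + 1] [c] 1" and ?g = "fps_hypergeo [a, b] [c] 1"
  have nz: "c + of_nat n \<noteq> 0" for n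
    using c by (metis add_eq_0_iff2 minus_of_nat_in_nonpos_Ints)
  hence nz': "pochhammer c n \<noteq> 0" for n
    by (auto simp: pochhammer_eq_0_iff add_eq_0_iff2)
  let ?P = "fps_X * (1 - fps_X) :: complex fps" and ?Q = "fps_const (c - b - 1) - fps_const a * fps_X"
  have eq: "fps_const (c - b - 1) * ?g = ?P * fps_deriv ?f + ?Q * ?f"
  proof (rule fps_ext)
    fix n show "(fps_const (c - b - 1) * ?g) $ n = (?P * fps_deriv ?f + ?Q * ?f) $ n"
    proof (cases n)
      case (Suc m)
      \<comment> \<open>The coefficients of \<open>?f\<close> and \<open>?g\<close> at
        \<open>Suc m\<close> are both rational multiples of \<open>u\<close>, which reduces the
        claim to an identity of rational functions in the parameters and \<open>m\<close>.\<close>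
      define u where "u = ?f $ m"
      have u: "u = pochhammer a m * pochhammer (b + 1) m / (pochhammer c m * of_nat (fact m))"
        by (simp add: u_def)
      have f: "?f $ Suc m = u * (a + of_nat m) * (b + 1 + of_nat m) / ((c + of_nat m) * (1 + of_nat m))"
        by (simp add: u_def fps_hypergeo_rec mult_ac del: fps_hypergeo_nth)
      have g: "?g $ Suc m = u * (a + of_nat m) * b / ((c + of_nat m) * (1 + of_nat m))"
        unfolding u by (simp add: pochhammer_Suc[of a] pochhammer_Suc[of c] pochhammer_rec[of b]) (simp add: algebra_simps)
      have d: "(fps_X * (1 - fps_X) * fps_deriv ?f) $ Suc m = of_nat (Suc m) * ?f $ Suc m - of_nat m * u"
        by (cases m) (simp_all add: mult.assoc u_def ring_distribs del: fps_hypergeo_nth of_nat_Suc)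
      have q: "(?Q * ?f) $ Suc m = (c - b - 1) * ?f $ Suc m - a * u"
        by (simp add: ring_distribs mult.assoc u_def del: fps_hypergeo_nth)
      have nz1: "1 + of_nat m \<noteq> (0::complex)" using of_nat_neq_0[of m, where 'a=complex] by simp
      have "(fps_const (c - b - 1) * ?g) $ Suc m = (of_nat (Suc m) + (c - b - 1)) * ?f $ Suc m - (of_nat m + a) * u"
        unfolding fps_mult_left_const_nth f g using nz[of m] nz1 by (simp add: divide_simps) algebra
      thus ?thesis unfolding Suc fps_add_nth d q by (simp add: algebra_simps del: fps_hypergeo_nth)
    qed (simp add: ring_distribs mult.assoc)
  qed
  show ?thesis
    unfolding hypergeo_continuation_def
  proof (intro conjI ballI)
    show "(\<lambda>z. (z * (1 - z) * deriv F z + (c - b - 1 - a * z) * F z) / (c - b - 1)) holomorphic_on slit_plane"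
      using F bc open_slit_plane by (auto simp: hypergeo_continuation_def intro!: holomorphic_intros)
  next
    fix z :: complex assume "z \<in> ball 0 1"
    hence z: "norm z < 1" by simp
    note r = norm_less_conv_radius_hypergeo[OF z, of a "b + 1" c]
    have r': "ereal (norm z) < fps_conv_radius (fps_deriv ?f)"
      using r fps_conv_radius_deriv[of ?f] by order
    \<comment> \<open>As polynomials, the two factors have infinite radius of convergence, so both
      products converge at \<open>z\<close>.\<close>
    have P: "?P = fps_of_poly [:0, 1, -1:]" and Q: "?Q = fps_of_poly [:c - b - 1, -a:]"
      by (simp_all add: fps_of_poly_pCons algebra_simps flip: fps_const_neg)
    have rp: "ereal (norm z) < fps_conv_radius (fps_of_poly p)" for p :: "complex poly" by simp
    have r1: "ereal (norm z) < fps_conv_radius (?P * fps_deriv ?f)"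
      unfolding P by (rule less_le_trans[OF _ fps_conv_radius_mult]) (use r' in simp)
    have r2: "ereal (norm z) < fps_conv_radius (?Q * ?f)"
      unfolding Q by (rule less_le_trans[OF _ fps_conv_radius_mult]) (use r in simp)
    have rg: "ereal (norm z) < fps_conv_radius ?g"
      using norm_less_conv_radius_hypergeo[OF z] .
    have "(c - b - 1) * eval_fps ?g z = eval_fps (fps_const (c - b - 1) * ?g) z"
      using rg by (simp add: eval_fps_mult)
    also have "\<dots> = eval_fps ?P z * eval_fps (fps_deriv ?f) z + eval_fps ?Q z * eval_fps ?f z"
      unfolding eq eval_fps_add[OF r1 r2] unfolding P Q using r r' rp by (simp add: eval_fps_mult)
    also have "\<dots> = z * (1 - z) * deriv F z + (c - b - 1 - a * z) * F z"
      unfolding hypergeo_continuation_deriv[OF F z] P Q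
      using F z by (simp add: hypergeo_continuation_def algebra_simps)
    finally show "(z * (1 - z) * deriv F z + (c - b - 1 - a * z) * F z) / (c - b - 1) = eval_fps ?g z"
      using bc by (simp add: field_simps)
  qed
qed

section \<open>Euler's integral\<close>

text \<open>If \<open>1 - z * t\<close> were a real number \<open>r \<le> 0\<close>, then
  \<open>z = (1 - r) / t \<ge> 1\<close> would lie on the cut. Hence the principal power in Euler's
  integrand is holomorphic in \<open>z\<close>.\<close>

lemma one_minus_mult_not_nonpos_Reals:
  assumes "z \<in> slit_plane" "t \<in> {0..1::real}"
  shows "1 - z * of_real t \<notin> \<real>\<^sub>\<le>\<^sub>0"
proof
  assume "1 - z * of_real t \<in> \<real>\<^sub>\<le>\<^sub>0"
  then obtain r where r: "r \<le> 0" "1 - z * of_real t = of_real r"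
    by (auto simp: nonpos_Reals_def)
  have t: "t \<noteq> 0" using r by (auto simp: complex_eq_iff)
  hence "z = of_real ((1 - r) / t)"
    using r(2) by (simp add: field_simps)
  moreover have "(1 - r) / t \<in> {1..}" using assms t r by (auto simp: field_simps)
  ultimately have "z \<in> of_real ` {1..}" by blast
  with assms show False by (simp add: slit_plane_def)
qed

lemma gbinomial_minus_mult_power:
  "(- d gchoose n) * (- u) ^ n = pochhammer d n / fact n * (u :: 'a :: field_char_0) ^ n"
proof -
  have "(- 1) ^ n * (- 1) ^ n = (1 :: 'a)" by (simp flip: power_mult_distrib)
  thus ?thesis by (simp add: gbinomial_pochhammer power_minus[of u])
qed

lemma continuous_on_powr_const_slit:
  assumes "continuous_on S f" "\<And>x. x \<in> S \<Longrightarrow> f x \<notin> \<real>\<^sub>\<le>\<^sub>0"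
  shows "continuous_on S (\<lambda>x. f x powr (a :: complex))"
  using assms by (intro continuous_on_powr_complex) (force simp: complex_nonpos_Reals_iff)+

lemma of_real_pos_not_nonpos_Ints:
  assumes "x > 0"
  shows "complex_of_real x \<notin> \<int>\<^sub>\<le>\<^sub>0"
proof
  assume "complex_of_real x \<in> \<int>\<^sub>\<le>\<^sub>0"
  then obtain n where n: "n \<le> 0" "complex_of_real x = of_int n"
    by (auto simp: nonpos_Ints_def)
  have "x = of_int n" using arg_cong[OF n(2), of Re] by simp
  thus False using n assms by simp
qed

text \<open>These are the moments of the Beta weight; divided by \<open>Beta x y\<close> they supply
  the quotients of Pochhammer symbols in the Gauss series.\<close>

lemma Beta_add_nat:
  fixes x y :: real
  assumes "x > 0" "y > 0"
  shows "Beta (x + of_nat n) y = pochhammer x n / pochhammer (x + y) n * Beta x y"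
proof -
  have "x \<notin> \<int>\<^sub>\<le>\<^sub>0" "x + y \<notin> \<int>\<^sub>\<le>\<^sub>0"
    using assms by (auto dest: nonpos_Ints_nonpos)
  moreover have "Gamma x > 0" "Gamma (x + y) > 0" "pochhammer (x + y) n > 0"
    using assms by (intro Gamma_real_pos pochhammer_pos; simp)+
  ultimately show ?thesis
    by (simp add: Beta_altdef rGamma_inverse_Gamma pochhammer_Gamma add_ac field_simps)
qed

text \<open>Differentiation under the integral sign gives holomorphy on the slit plane. On the unit
  disc the binomial series of the integrand converges uniformly in \<open>t\<close> and integrates
  term by term to Beta values. The bounds on \<open>b\<close> and \<open>c - b\<close> make the
  weight continuous on \<open>[0, 1]\<close>.\<close>

lemma Euler_integral_continuation:
  fixes a :: complex and b c :: real
  assumes b: "b > 1" and c: "c - b > 1"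
  shows "hypergeo_continuation a (of_real b) (of_real c)
    (\<lambda>z. integral {0..1} (\<lambda>t. (1 - z * of_real t) powr (-a) *
        of_real (t powr (b - 1) * (1 - t) powr (c - b - 1))) / of_real (Beta b (c - b)))"
proof -
  define w :: "real \<Rightarrow> real" where "w = (\<lambda>t. t powr (b - 1) * (1 - t) powr (c - b - 1))"
  define I where "I = (\<lambda>z. integral {0..1} (\<lambda>t. (1 - z * of_real t) powr (-a) * of_real (w t)))"
  have w_cont: "continuous_on {0..1} w"
    unfolding w_def using b c by (intro continuous_intros continuous_on_powr') auto
  have Beta_pos: "Beta b (c - b) > 0"
    unfolding Beta_altdef rGamma_inverse_Gamma using b c
    by (intro mult_pos_pos positive_imp_inverse_positive Gamma_real_pos) auto
  have "I holomorphic_on slit_plane"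
  proof (subst holomorphic_on_open[OF open_slit_plane], intro ballI)
    fix z0 assume "z0 \<in> slit_plane"
    then obtain e where e: "e > 0" "ball z0 e \<subseteq> slit_plane"
      using open_slit_plane by (auto simp: open_contains_ball)
    \<comment> \<open>The rule for differentiating under the integral wants a convex domain, which
      the slit plane is not; holomorphy is therefore shown on balls.\<close>
    define U where "U = ball z0 e"
    have "(\<lambda>z. integral (cbox 0 1) (\<lambda>t. (1 - z * of_real t) powr (-a) * of_real (w t))) holomorphic_on U"
    proof (rule leibniz_rule_holomorphic[where
          fx = "\<lambda>z t. a * of_real t * (1 - z * of_real t) powr (-a - 1) * of_real (w t)"])
      fix z t assume zt: "z \<in> U" "t \<in> cbox 0 (1::real)"
      have "1 - z * of_real t \<notin> \<real>\<^sub>\<le>\<^sub>0"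
        using zt e by (intro one_minus_mult_not_nonpos_Reals) (auto simp: U_def)
      thus "((\<lambda>z. (1 - z * of_real t) powr (-a) * of_real (w t)) has_field_derivative
              a * of_real t * (1 - z * of_real t) powr (-a - 1) * of_real (w t)) (at z within U)"
        by (auto intro!: derivative_eq_intros)
    next
      fix z assume z: "z \<in> U"
      show "(\<lambda>t. (1 - z * of_real t) powr (-a) * of_real (w t)) integrable_on cbox 0 1"
        using z e w_cont
        by (intro integrable_continuous continuous_intros continuous_on_powr_const_slit
              one_minus_mult_not_nonpos_Reals) (auto simp: U_def)
    next
      have "continuous_on (U \<times> cbox 0 1) (\<lambda>x. w (snd x))"
        by (rule continuous_on_compose2[OF w_cont continuous_on_snd[OF continuous_on_id]]) auto
      thus "continuous_on (U \<times> cbox 0 1)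
          (\<lambda>(z, t). a * of_real t * (1 - z * of_real t) powr (-a - 1) * of_real (w t))"
        unfolding case_prod_beta using e
        by (intro continuous_intros continuous_on_powr_const_slit one_minus_mult_not_nonpos_Reals)
          (auto simp: U_def)
    qed (simp add: U_def)
    hence "I holomorphic_on U" by (simp add: I_def)
    thus "\<exists>f'. (I has_field_derivative f') (at z0)"
      using e(1) by (subst (asm) holomorphic_on_open) (auto simp: U_def)
  qed
  moreover have "I z / of_real (Beta b (c - b)) = eval_fps (fps_hypergeo [a, of_real b] [of_real c] 1) z"
    if z: "norm z < 1" for z
  proof -
    \<comment> \<open>The power of \<open>t\<close> is left out of \<open>k\<close>, so that the
      norms of the \<open>k n\<close> are a summable majorant for all \<open>t\<close> in
      \<open>[0, 1]\<close> at once.\<close>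
    define k where "k = (\<lambda>n. (-a gchoose n) * (-z) ^ n)"
    have k: "summable (\<lambda>n. norm (k n))"
    proof -
      have "ereal (norm (-z)) < fps_conv_radius (fps_binomial (-a))"
        using z by (simp add: fps_conv_radius_binomial)
      from norm_summable_fps[OF this] show ?thesis by (simp add: k_def)
    qed
    have ks: "(\<lambda>n. k n * of_real t ^ n) sums (1 - z * of_real t) powr (-a)" if "t \<in> {0..1}" for t :: real
    proof -
      have "norm (- (z * of_real t)) \<le> norm z * 1"
        unfolding norm_minus_cancel norm_mult using that by (intro mult_left_mono) auto
      with z have "norm (- (z * of_real t)) < 1" by simp
      from gen_binomial_complex[OF this, of "-a"] show ?thesis
        by (simp add: k_def power_mult_distrib mult_ac power_minus[of z] power_minus[of "z * _"])
    qed
    have "uniform_limit {0..1} (\<lambda>n t. \<Sum>i<n. k i * of_real t ^ i * of_real (w t))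
        (\<lambda>t. (1 - z * of_real t) powr (-a) * of_real (w t)) sequentially"
    proof -
      have "uniform_limit {0..1} (\<lambda>n t. \<Sum>i<n. k i * of_real t ^ i)
          (\<lambda>t::real. \<Sum>i. k i * of_real t ^ i) sequentially"
        by (rule Weierstrass_m_test[OF _ k])
           (auto simp: norm_mult norm_power intro!: mult_left_le power_le_one)
      also have "?this \<longleftrightarrow> uniform_limit {0..1} (\<lambda>n t. \<Sum>i<n. k i * of_real t ^ i)
          (\<lambda>t::real. (1 - z * of_real t) powr (-a)) sequentially"
        by (intro uniform_limit_cong') (use ks in \<open>auto simp: sums_iff\<close>)
      finally have *: "uniform_limit {0..1} (\<lambda>n t. \<Sum>i<n. k i * of_real t ^ i)
          (\<lambda>t::real. (1 - z * of_real t) powr (-a)) sequentially" .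
      have cont: "continuous_on {0..1} (\<lambda>t. (1 - z * of_real t) powr (-a))"
        using z ball_subset_slit_plane
        by (intro continuous_intros continuous_on_powr_const_slit one_minus_mult_not_nonpos_Reals) auto
      have "uniform_limit {0..1} (\<lambda>n t. (\<Sum>i<n. k i * of_real t ^ i) * of_real (w t))
          (\<lambda>t. (1 - z * of_real t) powr (-a) * of_real (w t)) sequentially"
      proof (rule uniform_lim_mult[OF * uniform_limit_const])
        show "bounded ((\<lambda>t. (1 - z * of_real t) powr (-a)) ` {0..1})"
          by (intro compact_imp_bounded compact_continuous_image cont) auto
        show "bounded ((\<lambda>t. complex_of_real (w t)) ` {0..1})"
          by (intro compact_imp_bounded compact_continuous_image continuous_intros w_cont) auto
      qed
      thus ?thesis by (simp add: sum_distrib_right)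
    qed
    then obtain J L where JL:
      "\<And>n. ((\<lambda>t. \<Sum>i<n. k i * of_real t ^ i * of_real (w t)) has_integral J n) {0..1}"
      "((\<lambda>t. (1 - z * of_real t) powr (-a) * of_real (w t)) has_integral L) {0..1}"
      "J \<longlonglongrightarrow> L"
      by (rule uniform_limit_integral) (use w_cont in \<open>auto intro!: continuous_intros\<close>)
    have Beta_term: "((\<lambda>t. k i * of_real t ^ i * of_real (w t)) has_integral
        k i * of_real (Beta (b + of_nat i) (c - b))) {0..1}" for i
    proof -
      have "((\<lambda>t. t powr (b + of_nat i - 1) * (1 - t) powr (c - b - 1)) has_integral Beta (b + of_nat i) (c - b)) {0..1}"
        using b c by (intro has_integral_Beta_real) auto
      also have "?this \<longleftrightarrow> ((\<lambda>t. t ^ i * w t) has_integral Beta (b + of_nat i) (c - b)) {0..1}"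
      proof (rule has_integral_cong)
        fix t :: real assume "t \<in> {0..1}"
        thus "t powr (b + of_nat i - 1) * (1 - t) powr (c - b - 1) = t ^ i * w t"
          using b by (cases "t = 0") (auto simp: w_def powr_add powr_diff powr_realpow)
      qed
      finally have "((\<lambda>t. k i * of_real (t ^ i * w t)) has_integral k i * of_real (Beta (b + of_nat i) (c - b))) {0..1}"
        by (intro has_integral_mult_right has_integral_of_real)
      thus ?thesis by (simp add: mult_ac)
    qed
    have "J = (\<lambda>n. \<Sum>i<n. k i * of_real (Beta (b + of_nat i) (c - b)))"
      by (intro ext has_integral_unique[OF JL(1) has_integral_sum] Beta_term) auto
    with JL(3) have "(\<lambda>i. k i * of_real (Beta (b + of_nat i) (c - b))) sums L"
      unfolding sums_def by (simp only:)
    hence "(\<lambda>i. k i * of_real (Beta (b + of_nat i) (c - b)) / of_real (Beta b (c - b))) sums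
        (L / of_real (Beta b (c - b)))"
      by (rule sums_divide)
    also have "(\<lambda>i. k i * of_real (Beta (b + of_nat i) (c - b)) / of_real (Beta b (c - b))) =
        (\<lambda>i. fps_hypergeo [a, of_real b] [of_real c] 1 $ i * z ^ i)"
    proof
      fix i
      have "k i = pochhammer a i / fact i * z ^ i"
        unfolding k_def by (rule gbinomial_minus_mult_power)
      thus "k i * of_real (Beta (b + of_nat i) (c - b)) / of_real (Beta b (c - b)) =
          fps_hypergeo [a, of_real b] [of_real c] 1 $ i * z ^ i"
        using Beta_pos b c by (simp add: Beta_add_nat pochhammer_of_real mult_ac)
    qed
    finally have "eval_fps (fps_hypergeo [a, of_real b] [of_real c] 1) z = L / of_real (Beta b (c - b))"
      by (simp add: eval_fps_def sums_iff)
    thus ?thesis using JL(2) by (simp add: I_def integral_unique)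
  qed
  ultimately show ?thesis
    using Beta_pos by (auto simp: hypergeo_continuation_def I_def w_def intro!: holomorphic_intros)
qed

text \<open>
  Raising \<open>b\<close> and then \<open>c\<close> by integers makes the integrand of Euler's integral continuous on
  \<open>[0, 1]\<close>; the contiguous relations lead back to the original parameters.
\<close>

lemma hypergeo_continuation_exists:
  fixes a :: complex and b c :: real
  assumes "c > 0"
  shows "\<exists>F. hypergeo_continuation a (of_real b) (of_real c) F"
proof -
  \<comment> \<open>\<open>n\<close> lifts \<open>b\<close> above 1, and \<open>m\<close> then lifts
    \<open>c\<close> until the difference exceeds 1, as Euler's integral requires. The way back
    lowers \<open>b\<close> first, with the third parameter held at \<open>c + m\<close>, and
    \<open>c\<close> afterwards.\<close>
  define n where "n = nat \<lceil>2 - b\<rceil>"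
  define m where "m = nat \<lceil>2 + b + n\<rceil>"
  have n: "b + n > 1" unfolding n_def by linarith
  have m: "c + m - (b + n) > 1" unfolding m_def using assms by linarith
  have "\<exists>F. hypergeo_continuation a (of_real (b + real (n - i))) (of_real (c + m)) F" if "i \<le> n" for i
    using that
  proof (induction i)
    case 0
    show ?case using Euler_integral_continuation[OF n m] by auto
  next
    case (Suc i)
    then obtain F where "hypergeo_continuation a (of_real (b + real (n - i))) (of_real (c + m)) F" by auto
    moreover have "real (n - i) = real (n - Suc i) + 1" using Suc.prems by auto
    ultimately have F: "hypergeo_continuation a (of_real (b + real (n - Suc i)) + 1) (of_real (c + m)) F"
      by (simp add: add_ac)
    have "complex_of_real (c + m) \<notin> \<int>\<^sub>\<le>\<^sub>0"
      using assms by (intro of_real_pos_not_nonpos_Ints) auto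
    \<comment> \<open>The margin secured by \<open>m\<close> also keeps the divisor
      \<open>c - b - 1\<close> of the contiguous relation nonzero, since the second parameter never
      exceeds \<open>b + n\<close>.\<close>
    moreover have "c + m - (b + real (n - Suc i)) - 1 \<noteq> 0" using m by auto
    hence "complex_of_real (c + m - (b + real (n - Suc i)) - 1) \<noteq> 0" by (subst of_real_eq_0_iff)
    ultimately show ?case using hypergeo_continuation_lower_b[OF F] by auto
  qed
  from this[of n] have base: "\<exists>F. hypergeo_continuation a (of_real b) (of_real (c + m)) F" by simp
  have "\<exists>F. hypergeo_continuation a (of_real b) (of_real (c + real (m - i))) F" if "i \<le> m" for i
    using that
  proof (induction i)
    case 0
    show ?case using base by simp
  next
    case (Suc i)
    then obtain F where "hypergeo_continuation a (of_real b) (of_real (c + real (m - i))) F" by auto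
    moreover have "real (m - i) = real (m - Suc i) + 1" using Suc.prems by auto
    ultimately have F: "hypergeo_continuation a (of_real b) (of_real (c + real (m - Suc i)) + 1) F"
      by (simp add: add_ac)
    have "complex_of_real (c + real (m - Suc i)) \<notin> \<int>\<^sub>\<le>\<^sub>0"
      using assms by (intro of_real_pos_not_nonpos_Ints) auto
    thus ?case using hypergeo_continuation_lower_c[OF F] by auto
  qed
  from this[of m] show ?thesis by simp
qed

section \<open>Pfaff's transformation\<close>

text \<open>The expansion of \<open>(1 - z) powr - d\<close>.\<close>

definition fps_geom_pow :: "complex \<Rightarrow> complex fps" where
  "fps_geom_pow d = Abs_fps (\<lambda>n. pochhammer d n / fact n)"

lemma fps_geom_pow_expansion: "(\<lambda>z. (1 - z) powr (-d)) has_fps_expansion fps_geom_pow d"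
proof (rule has_fps_expansionI)
  have "eventually (\<lambda>u::complex. u \<in> ball 0 1) (nhds 0)"
    by (intro eventually_nhds_in_open) auto
  thus "eventually (\<lambda>u. (\<lambda>n. fps_geom_pow d $ n * u ^ n) sums (1 - u) powr (-d)) (nhds 0)"
  proof eventually_elim
    case (elim u)
    hence "norm (-u) < 1" by simp
    from gen_binomial_complex[OF this, of "-d"] show ?case
      by (simp add: fps_geom_pow_def gbinomial_minus_mult_power)
  qed
qed

text \<open>The law of exponents for \<open>powr\<close> is carried over to formal series by
  uniqueness of power series expansions.\<close>

lemma fps_geom_pow_add: "fps_geom_pow (d + e) = fps_geom_pow d * fps_geom_pow e"
proof (rule fps_expansion_unique_complex)
  show "(\<lambda>z. (1 - z) powr (-(d + e))) has_fps_expansion fps_geom_pow (d + e)"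
    by (rule fps_geom_pow_expansion)
  have "(\<lambda>z. (1 - z) powr (-d) * (1 - z) powr (-e)) has_fps_expansion fps_geom_pow d * fps_geom_pow e"
    by (intro has_fps_expansion_mult fps_geom_pow_expansion)
  also have "(\<lambda>z. (1 - z) powr (-d) * (1 - z) powr (-e)) = (\<lambda>z. (1 - z) powr (-(d + e)))"
    unfolding minus_add_distrib powr_add ..
  finally show "(\<lambda>z. (1 - z) powr (-(d + e))) has_fps_expansion fps_geom_pow d * fps_geom_pow e" .
qed

lemma fps_geom_pow_power: "fps_geom_pow 1 ^ k = fps_geom_pow (of_nat k)"
proof (induction k)
  case 0
  show ?case by (rule fps_ext) (simp add: fps_geom_pow_def pochhammer_0_left)
next
  case (Suc k)
  thus ?case by (simp add: fps_geom_pow_add)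
qed

lemma pochhammer_minus_of_nat:
  assumes "k \<le> n"
  shows "pochhammer (- of_nat n) k = ((-1) ^ k * fact n / fact (n - k) :: 'a :: field_char_0)"
proof -
  have "(fact n :: 'a) = pochhammer 1 (n - k) * pochhammer (1 + of_nat (n - k)) k"
    using assms pochhammer_product[of "n - k" n "1 :: 'a"] by (simp add: pochhammer_fact)
  also have "pochhammer 1 (n - k) = (fact (n - k) :: 'a)"
    by (simp add: pochhammer_fact)
  finally have "pochhammer (1 + of_nat (n - k)) k = (fact n / fact (n - k) :: 'a)"
    by (simp add: field_simps)
  thus ?thesis
    using assms by (simp add: pochhammer_minus of_nat_diff add_ac)
qed

text \<open>The substituted series is the expansion of \<open>z / (z - 1)\<close>. The coefficient
  of order \<open>n\<close> on the left is \<open>pochhammer a n / fact n\<close> times the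
  terminating sum \<open>2F1(-n, c - b; c; 1)\<close>, which the Chu-Vandermonde identity
  evaluates.\<close>

lemma fps_hypergeo_pfaff:
  assumes c: "c \<notin> \<int>\<^sub>\<le>\<^sub>0"
  shows "fps_geom_pow a * (fps_hypergeo [a, c - b] [c] 1 oo (- (fps_X * fps_geom_pow 1))) =
      fps_hypergeo [a, b] [c] 1"
proof (rule fps_ext)
  fix n
  let ?g = "fps_hypergeo [a, c - b] [c] 1" and ?B = "- (fps_X * fps_geom_pow 1)"
  \<comment> \<open>As \<open>?B\<close> has no constant term, the inner sums below can all be
    extended to the common range \<open>k \<le> n\<close>, after which the order of summation can be
    exchanged.\<close>
  have B: "(?B ^ k) $ m = 0" if "m < k" for k m
    using startsby_zero_power_prefix[of ?B k] that by simp
  have AB: "(fps_geom_pow a * ?B ^ k) $ n = (-1) ^ k * (pochhammer (a + of_nat k) (n - k) / fact (n - k))"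
    if "k \<le> n" for k
  proof -
    have "?B = fps_const (-1) * (fps_X * fps_geom_pow 1)"
      by (simp flip: fps_const_neg)
    hence "fps_geom_pow a * ?B ^ k = fps_const ((-1) ^ k) * (fps_X ^ k * fps_geom_pow (a + of_nat k))"
      by (simp only: fps_geom_pow_add fps_geom_pow_power power_mult_distrib mult_ac fps_const_power)
    thus ?thesis using that
      by (simp add: fps_X_power_mult_nth) (simp add: fps_geom_pow_def)
  qed
  have "(fps_geom_pow a * (?g oo ?B)) $ n =
      (\<Sum>i=0..n. fps_geom_pow a $ i * (\<Sum>k=0..n - i. ?g $ k * (?B ^ k) $ (n - i)))"
    by (simp add: fps_mult_nth fps_compose_nth del: fps_hypergeo_nth)
  also have "\<dots> = (\<Sum>i=0..n. fps_geom_pow a $ i * (\<Sum>k=0..n. ?g $ k * (?B ^ k) $ (n - i)))"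
  proof (rule sum.cong[OF refl], rule arg_cong2[where f = "(*)", OF refl])
    fix i
    show "(\<Sum>k=0..n - i. ?g $ k * (?B ^ k) $ (n - i)) = (\<Sum>k=0..n. ?g $ k * (?B ^ k) $ (n - i))"
      by (rule sum.mono_neutral_left) (auto simp del: fps_hypergeo_nth simp: B)
  qed
  also have "\<dots> = (\<Sum>k=0..n. \<Sum>i=0..n. ?g $ k * (fps_geom_pow a $ i * (?B ^ k) $ (n - i)))"
    unfolding sum_distrib_left by (subst sum.swap) (simp only: mult_ac)
  also have "\<dots> = (\<Sum>k=0..n. ?g $ k * (fps_geom_pow a * ?B ^ k) $ n)"
    by (simp only: fps_mult_nth sum_distrib_left)
  also have "\<dots> = (\<Sum>k=0..n. pochhammer a n / fact n *
      (pochhammer (c - b) k * pochhammer (- of_nat n) k / (of_nat (fact k) * pochhammer c k)))"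
  proof (intro sum.cong refl)
    fix k assume k: "k \<in> {0..n}"
    have "pochhammer a n = pochhammer a k * pochhammer (a + of_nat k) (n - k)"
      using k by (intro pochhammer_product) auto
    thus "?g $ k * (fps_geom_pow a * ?B ^ k) $ n = pochhammer a n / fact n *
      (pochhammer (c - b) k * pochhammer (- of_nat n) k / (of_nat (fact k) * pochhammer c k))"
      using k by (simp add: AB pochhammer_minus_of_nat mult_ac)
  qed
  also have "\<dots> = pochhammer a n / fact n * (pochhammer (c - (c - b)) n / pochhammer c n)"
    unfolding sum_distrib_left [symmetric]
    by (subst Vandermonde_pochhammer) (use c in auto)
  also have "\<dots> = fps_hypergeo [a, b] [c] 1 $ n" by simp
  finally show "(fps_geom_pow a * (?g oo ?B)) $ n = fps_hypergeo [a, b] [c] 1 $ n" .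
qed

text \<open>Both sides are holomorphic on the half-plane \<open>Re z < 1 / 2\<close> and agree near
  0 by the formal identity, so the identity theorem applies. Since \<open>F\<close> is arbitrary,
  the choice made in \<open>hyp2F1\<close> does not influence its values on this half-plane.\<close>

lemma hypergeo_continuation_pfaff:
  assumes F: "hypergeo_continuation a b c F" and c: "c \<notin> \<int>\<^sub>\<le>\<^sub>0" and z: "Re z < 1 / 2"
  shows "F z = (1 - z) powr (-a) * eval_fps (fps_hypergeo [a, c - b] [c] 1) (z / (z - 1))"
proof -
  let ?g = "fps_hypergeo [a, c - b] [c] 1"
  define S where "S = {z. Re z < 1 / 2}"
  define H where "H = (\<lambda>z. (1 - z) powr (-a) * eval_fps ?g (z / (z - 1)))"
  have "(\<lambda>z. - (z * (1 - z) powr (- 1))) has_fps_expansion (- (fps_X * fps_geom_pow 1))"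
    by (intro has_fps_expansion_mult fps_geom_pow_expansion has_fps_expansion_minus has_fps_expansion_fps_X)
  \<comment> \<open>At \<open>z = 1\<close> the two functions agree as well:
    \<open>0 powr (- 1)\<close> and division by zero both give 0.\<close>
  also have "(\<lambda>z. - (z * (1 - z) powr (- 1))) = (\<lambda>z::complex. z / (z - 1))"
    by (auto simp: fun_eq_iff powr_minus divide_simps) (simp_all add: algebra_simps)?
  finally have "(eval_fps ?g \<circ> (\<lambda>z. z / (z - 1))) has_fps_expansion (?g oo (- (fps_X * fps_geom_pow 1)))"
    using norm_less_conv_radius_hypergeo[of 0 a "c - b" c]
    by (intro has_fps_expansion_compose eval_fps_has_fps_expansion) (auto simp: zero_ereal_def)
  hence "H has_fps_expansion (fps_geom_pow a * (?g oo (- (fps_X * fps_geom_pow 1))))"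
    unfolding H_def by (intro has_fps_expansion_mult fps_geom_pow_expansion) (simp add: o_def)
  hence "H has_fps_expansion fps_hypergeo [a, b] [c] 1"
    using c by (simp only: fps_hypergeo_pfaff not_False_eq_True)
  hence "eventually (\<lambda>z. eval_fps (fps_hypergeo [a, b] [c] 1) z = H z) (nhds 0)"
    by (simp add: has_fps_expansion_def)
  then obtain X where X: "open X" "0 \<in> X" "\<And>z. z \<in> X \<Longrightarrow> eval_fps (fps_hypergeo [a, b] [c] 1) z = H z"
    by (auto simp: eventually_nhds)
  \<comment> \<open>The half-plane consists of the points closer to 0 than to 1.\<close>
  have lt: "norm (z / (z - 1)) < 1" if "z \<in> S" for z
  proof -
    have "(norm z)\<^sup>2 < (norm (z - 1))\<^sup>2"
      using that unfolding cmod_power2 by (auto simp: S_def power2_eq_square algebra_simps)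
    hence "norm z < norm (z - 1)" using power2_less_imp_less by fastforce
    thus ?thesis by (simp add: norm_divide divide_simps)
  qed
  have sub: "S \<subseteq> slit_plane" by (auto simp: S_def slit_plane_def)
  show ?thesis
    unfolding H_def[symmetric] fun_cong[OF H_def[symmetric]]
  proof (rule analytic_continuation_open[where s = "S \<inter> X \<inter> ball 0 1" and s' = S and f = F and g = H])
    show "open S" unfolding S_def by (rule open_halfspace_Re_lt)
    thus "open (S \<inter> X \<inter> ball 0 1)" using X by auto
    have "0 \<in> S \<inter> X \<inter> ball 0 1" using X by (simp add: S_def)
    thus "S \<inter> X \<inter> ball 0 1 \<noteq> {}" by blast
    show "connected S" unfolding S_def by (intro convex_connected convex_halfspace_Re_lt)
    show "S \<inter> X \<inter> ball 0 1 \<subseteq> S" by auto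
    show "F holomorphic_on S"
      using F sub by (auto simp: hypergeo_continuation_def intro: holomorphic_on_subset)
    show "H holomorphic_on S"
      unfolding H_def
    proof (rule holomorphic_on_mult)
      show "(\<lambda>z. (1 - z) powr (-a)) holomorphic_on S"
        by (intro holomorphic_intros) (auto simp: S_def complex_nonpos_Reals_iff)
      show "(\<lambda>z. eval_fps ?g (z / (z - 1))) holomorphic_on S"
      proof -
        have "(eval_fps ?g \<circ> (\<lambda>z. z / (z - 1))) holomorphic_on S"
        proof (rule holomorphic_on_compose_gen)
          show "(\<lambda>z. z / (z - 1)) holomorphic_on S"
            by (intro holomorphic_intros) (auto simp: S_def)
          show "eval_fps ?g holomorphic_on ball 0 1"
            by (intro holomorphic_on_eval_fps) (auto simp: dist_norm norm_less_conv_radius_hypergeo simp del: One_nat_def)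
        qed (use lt in \<open>auto simp: norm_divide\<close>)
        thus ?thesis by (simp add: o_def)
      qed
    qed
    show "F z = H z" if "z \<in> S \<inter> X \<inter> ball 0 1" for z
      using that X(3)[of z] F by (auto simp: hypergeo_continuation_def)
    show "z \<in> S" using z by (simp add: S_def)
  qed
qed

section \<open>Comparison up to constants\<close>

text \<open>The constant is an explicit argument, so that uniformity in \<open>l\<close>,
  \<open>t\<close> or \<open>n\<close> can be stated by quantifying over these after
  \<open>C\<close>. Positivity is built in so that quotients and real powers remain
  comparable.\<close>

definition comparable :: "real \<Rightarrow> real \<Rightarrow> real \<Rightarrow> bool" where
  "comparable C x y \<longleftrightarrow> 0 < x \<and> 0 < y \<and> x \<le> C * y \<and> y \<le> C * x"

lemma comparable_pos: "comparable C x y \<Longrightarrow> 0 < C"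
  unfolding comparable_def by (metis less_le_trans zero_less_mult_pos2)

lemma comparable_refl: "x > 0 \<Longrightarrow> comparable 1 x x"
  by (simp add: comparable_def)

lemma comparable_trans:
  assumes "comparable C x y" "comparable D y z"
  shows "comparable (C * D) x z"
proof -
  have "C > 0" "D > 0" using assms comparable_pos by auto
  hence "C * y \<le> C * (D * z)" "D * y \<le> D * (C * x)"
    using assms by (auto simp: comparable_def)
  thus ?thesis using assms by (auto simp: comparable_def mult_ac)
qed

lemma comparable_mult:
  assumes "comparable C x y" "comparable D u v"
  shows "comparable (C * D) (x * u) (y * v)"
proof -
  have "C > 0" "D > 0" using assms comparable_pos by auto
  hence "x * u \<le> (C * y) * (D * v)" "y * v \<le> (C * x) * (D * u)"
    using assms by (auto simp: comparable_def intro!: mult_mono)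
  thus ?thesis using assms by (auto simp: comparable_def mult_ac)
qed

lemma comparable_powr:
  assumes "comparable C x y"
  shows "comparable (C powr \<bar>e\<bar>) (x powr e) (y powr e)"
proof -
  have C: "C > 0" using assms comparable_pos by auto
  have *: "u powr e \<le> C powr \<bar>e\<bar> * v powr e"
    if "u > 0" "v > 0" "u \<le> C * v" "v \<le> C * u" for u v
  proof (cases "e \<ge> 0")
    case True
    hence "u powr e \<le> (C * v) powr e" using that by (intro powr_mono2) auto
    thus ?thesis using True that C by (simp add: powr_mult)
  next
    case False
    hence "(C * u) powr e \<le> v powr e" using that by (intro powr_mono2') auto
    thus ?thesis using False that C by (simp add: powr_mult powr_minus field_simps)
  qed
  thus ?thesis using assms by (auto simp: comparable_def)
qed

lemma comparable_divide:
  assumes "comparable C x y" "comparable D u v"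
  shows "comparable (C * D) (x / u) (y / v)"
proof -
  have "comparable D (inverse u) (inverse v)"
    using assms(2) by (auto simp: comparable_def field_simps)
  from comparable_mult[OF assms(1) this] show ?thesis by (simp add: divide_inverse)
qed

lemma comparable_weaken: "comparable C x y \<Longrightarrow> C \<le> D \<Longrightarrow> comparable D x y"
  unfolding comparable_def by (meson less_imp_le mult_right_mono order_trans)

section \<open>Uniform comparison of products of Pochhammer symbols\<close>

text \<open>Because \<open>p + q = r + s\<close>, the factors of index \<open>j\<close> on the two
  sides differ by exactly \<open>p * q - r * s\<close>, whatever the shift. Their quotient is thus
  at most \<open>1 + e j\<close> with \<open>e j\<close> of order \<open>1 / j^2\<close>, and the
  product of these bounds converges.\<close>

lemma pochhammer_mult_le:
  fixes p q r s :: real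
  assumes pos: "p > 0" "q > 0" "r > 0" "s > 0" and eq: "p + q = r + s"
  obtains C where "\<And>\<mu> n. \<mu> \<ge> 0 \<Longrightarrow> pochhammer (p + \<mu>) n * pochhammer (q + \<mu>) n \<le>
    C * (pochhammer (r + \<mu>) n * pochhammer (s + \<mu>) n)"
proof -
  define D where "D = \<bar>p * q - r * s\<bar>"
  \<comment> \<open>\<open>e j\<close> is the relative difference in absolute value at shift 0; a
    shift \<open>\<mu> \<ge> 0\<close> only enlarges the denominator. The majorant with
    \<open>M\<close> rests on \<open>r + j \<ge> min r 1 * (1 + j)\<close> and the same for
    \<open>s\<close>.\<close>
  define e where "e = (\<lambda>j. D / ((r + real j) * (s + real j)))"
  define M where "M = D / (min r 1 * min s 1)"
  have e_nonneg: "e j \<ge> 0" for j using pos by (auto simp: e_def D_def)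
  have "summable (\<lambda>j. M * inverse (real (Suc j) ^ 2))"
    by (intro summable_mult) (subst summable_Suc_iff, rule inverse_power_summable, simp)
  moreover have "e j \<le> M * inverse (real (Suc j) ^ 2)" for j
  proof -
    have "min r 1 * real (Suc j) \<le> r + real j" "min s 1 * real (Suc j) \<le> s + real j"
      using pos by (auto simp: min_def algebra_simps mult_left_le_one_le mult_le_cancel_right1)
    hence "(min r 1 * real (Suc j)) * (min s 1 * real (Suc j)) \<le> (r + real j) * (s + real j)"
      using pos by (intro mult_mono) auto
    hence "e j \<le> D / ((min r 1 * real (Suc j)) * (min s 1 * real (Suc j)))"
      unfolding e_def using pos by (intro divide_left_mono) (auto simp: D_def)
    thus ?thesis by (simp add: M_def divide_inverse power2_eq_square mult_ac)
  qed
  ultimately have "summable e"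
    using e_nonneg by (intro summable_comparison_test[of e "\<lambda>j. M * inverse (real (Suc j) ^ 2)"] exI[of _ 0]) simp_all
  have "pochhammer (p + \<mu>) n * pochhammer (q + \<mu>) n \<le>
      exp (\<Sum>j<n. e j) * (pochhammer (r + \<mu>) n * pochhammer (s + \<mu>) n)" if mu: "\<mu> \<ge> 0" for \<mu> n
  proof (induction n)
    case (Suc n)
    have "(r + real n) * (s + real n) \<le> (r + \<mu> + real n) * (s + \<mu> + real n)"
      using pos mu by (intro mult_mono) auto
    hence "e n * ((r + real n) * (s + real n)) \<le> e n * ((r + \<mu> + real n) * (s + \<mu> + real n))"
      by (intro mult_left_mono e_nonneg)
    moreover have "r + real n > 0" "s + real n > 0" using pos by auto
    hence "e n * ((r + real n) * (s + real n)) = D" by (simp add: e_def)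
    moreover have "(p + \<mu> + real n) * (q + \<mu> + real n) - (r + \<mu> + real n) * (s + \<mu> + real n) = p * q - r * s"
    proof -
      have "(p + \<mu> + real n) * (q + \<mu> + real n) = p * q + (p + q) * (\<mu> + real n) + (\<mu> + real n) ^ 2"
        by (simp add: algebra_simps power2_eq_square)
      moreover have "(r + \<mu> + real n) * (s + \<mu> + real n) = r * s + (r + s) * (\<mu> + real n) + (\<mu> + real n) ^ 2"
        by (simp add: algebra_simps power2_eq_square)
      ultimately show ?thesis using eq by simp
    qed
    ultimately have "(p + \<mu> + real n) * (q + \<mu> + real n) \<le> (1 + e n) * ((r + \<mu> + real n) * (s + \<mu> + real n))"
      by (simp add: D_def distrib_right)
    also have "\<dots> \<le> exp (e n) * ((r + \<mu> + real n) * (s + \<mu> + real n))"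
      using pos mu by (intro mult_right_mono exp_ge_add_one_self) auto
    finally have "(pochhammer (p + \<mu>) n * pochhammer (q + \<mu>) n) * ((p + \<mu> + real n) * (q + \<mu> + real n)) \<le>
       (exp (\<Sum>j<n. e j) * (pochhammer (r + \<mu>) n * pochhammer (s + \<mu>) n)) *
       (exp (e n) * ((r + \<mu> + real n) * (s + \<mu> + real n)))"
      using pos mu by (intro mult_mono[OF Suc.IH] mult_nonneg_nonneg pochhammer_nonneg) auto
    thus ?case by (simp add: pochhammer_Suc exp_add mult_ac)
  qed simp
  moreover have "exp (\<Sum>j<n. e j) * (pochhammer (r + \<mu>) n * pochhammer (s + \<mu>) n) \<le>
      exp (suminf e) * (pochhammer (r + \<mu>) n * pochhammer (s + \<mu>) n)" if "\<mu> \<ge> 0" for \<mu> n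
  proof (rule mult_right_mono)
    show "exp (\<Sum>j<n. e j) \<le> exp (suminf e)"
      using \<open>summable e\<close> e_nonneg by (simp add: sum_le_suminf)
    show "0 \<le> pochhammer (r + \<mu>) n * pochhammer (s + \<mu>) n"
      using pos that by (intro mult_nonneg_nonneg pochhammer_nonneg) auto
  qed
  ultimately have "pochhammer (p + \<mu>) n * pochhammer (q + \<mu>) n \<le>
      exp (suminf e) * (pochhammer (r + \<mu>) n * pochhammer (s + \<mu>) n)" if "\<mu> \<ge> 0" for \<mu> n
    using that by (meson order_trans)
  thus ?thesis by (rule that)
qed

lemma pochhammer_mult_comparable:
  fixes p q r s :: real
  assumes pos: "p > 0" "q > 0" "r > 0" "s > 0" and eq: "p + q = r + s"
  obtains C where "\<And>\<mu> n. \<mu> \<ge> 0 \<Longrightarrow> comparable C (pochhammer (p + \<mu>) n * pochhammer (q + \<mu>) n)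
    (pochhammer (r + \<mu>) n * pochhammer (s + \<mu>) n)"
proof -
  obtain C where C: "\<And>\<mu> n. \<mu> \<ge> 0 \<Longrightarrow> pochhammer (p + \<mu>) n * pochhammer (q + \<mu>) n \<le>
    C * (pochhammer (r + \<mu>) n * pochhammer (s + \<mu>) n)"
    using pochhammer_mult_le[OF pos eq] by metis
  obtain D where D: "\<And>\<mu> n. \<mu> \<ge> 0 \<Longrightarrow> pochhammer (r + \<mu>) n * pochhammer (s + \<mu>) n \<le>
    D * (pochhammer (p + \<mu>) n * pochhammer (q + \<mu>) n)"
    using pochhammer_mult_le[OF pos(3,4,1,2) eq[symmetric]] by metis
  show ?thesis
  proof (rule that[of "max C D"])
    fix \<mu> :: real and n assume mu: "\<mu> \<ge> 0"
    have p: "pochhammer (p + \<mu>) n * pochhammer (q + \<mu>) n > 0" "pochhammer (r + \<mu>) n * pochhammer (s + \<mu>) n > 0"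
      using pos mu by (auto intro!: mult_pos_pos pochhammer_pos)
    have "x \<le> max C D * y" "y \<le> max C D * x" if "x > 0" "y > 0" "x \<le> C * y" "y \<le> D * x" for x y
      using that mult_right_mono[of C "max C D" y] mult_right_mono[of D "max C D" x] by linarith+
    thus "comparable (max C D) (pochhammer (p + \<mu>) n * pochhammer (q + \<mu>) n)
      (pochhammer (r + \<mu>) n * pochhammer (s + \<mu>) n)"
      unfolding comparable_def using p C[OF mu, of n] D[OF mu, of n] by blast
  qed
qed

section \<open>The series 2F1(K + l, 1; K + 1; x)\<close>

text \<open>For \<open>0 < x < 1\<close> this is \<open>K x^(-K) (1 - x)^(-l)\<close> times the
  incomplete Beta integral of \<open>u^(K - 1) (1 - u)^(l - 1)\<close> over
  \<open>[0, x]\<close>.\<close>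

definition hyp_one :: "real \<Rightarrow> real \<Rightarrow> real \<Rightarrow> real" where
  "hyp_one K l = eval_fps (fps_hypergeo [K + l, 1] [K + 1] 1)"

lemma hyp_one_has_derivative:
  assumes K: "K > 0" and x: "\<bar>x\<bar> < 1"
  obtains f' where "(hyp_one K l has_real_derivative f') (at x)"
    "x * (1 - x) * f' + (K - (K + l) * x) * hyp_one K l x = K"
proof -
  let ?f = "fps_hypergeo [K + l, 1] [K + 1] 1 :: real fps"
  let ?P = "fps_X * (1 - fps_X) :: real fps" and ?Q = "fps_const K - fps_const (K + l) * fps_X"
  have eq: "?P * fps_deriv ?f + ?Q * ?f = fps_const K"
  proof (rule fps_ext)
    fix n show "(?P * fps_deriv ?f + ?Q * ?f) $ n = fps_const K $ n"
    proof (cases n)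
      case (Suc m)
      have rec: "(K + 1 + real m) * ?f $ Suc m = (K + l + real m) * ?f $ m"
        using K by (simp add: fps_hypergeo_rec del: fps_hypergeo_nth)
      have d: "(?P * fps_deriv ?f) $ Suc m = real (Suc m) * ?f $ Suc m - real m * ?f $ m"
        by (cases m) (simp_all add: mult.assoc ring_distribs del: fps_hypergeo_nth of_nat_Suc)
      have q: "(?Q * ?f) $ Suc m = K * ?f $ Suc m - (K + l) * ?f $ m"
        by (simp add: left_diff_distrib mult.assoc del: fps_hypergeo_nth)
      show ?thesis unfolding Suc fps_add_nth d q using rec
        by (simp add: algebra_simps del: fps_hypergeo_nth)
    qed (simp add: ring_distribs mult.assoc)
  qed
  have r: "ereal (norm x) < fps_conv_radius ?f" using x by (intro norm_less_conv_radius_hypergeo) auto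
  have r': "ereal (norm x) < fps_conv_radius (fps_deriv ?f)"
    using r fps_conv_radius_deriv[of ?f] by order
  have P: "?P = fps_of_poly [:0, 1, -1:]" and Q: "?Q = fps_of_poly [:K, -(K + l):]"
    by (simp_all add: fps_of_poly_pCons algebra_simps flip: fps_const_neg)
  have r1: "ereal (norm x) < fps_conv_radius (?P * fps_deriv ?f)"
    unfolding P by (rule less_le_trans[OF _ fps_conv_radius_mult]) (use r' in simp)
  have r2: "ereal (norm x) < fps_conv_radius (?Q * ?f)"
    unfolding Q by (rule less_le_trans[OF _ fps_conv_radius_mult]) (use r in simp)
  have "K = eval_fps (?P * fps_deriv ?f + ?Q * ?f) x" by (simp add: eq)
  also have "\<dots> = eval_fps ?P x * eval_fps (fps_deriv ?f) x + eval_fps ?Q x * eval_fps ?f x"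
    unfolding eval_fps_add[OF r1 r2] unfolding P Q using r r' by (simp add: eval_fps_mult)
  also have "\<dots> = x * (1 - x) * eval_fps (fps_deriv ?f) x + (K - (K + l) * x) * eval_fps ?f x"
    unfolding P Q by (simp add: algebra_simps)
  finally show ?thesis
    by (intro that[of "eval_fps (fps_deriv ?f) x"])
       (auto simp: hyp_one_def intro!: has_field_derivative_eval_fps r)
qed

text \<open>The series alternates at \<open>- y\<close>, so its sign is read off the differential
  equation instead: multiplied by the integrating factor \<open>y^K (1 + y)^l\<close>, the function
  vanishes at 0 and has a nonnegative derivative.\<close>

lemma hyp_one_minus_nonneg:
  assumes K: "K > 0" and y: "0 \<le> y" "y < 1"
  shows "hyp_one K l (- y) \<ge> 0"
proof (cases "y = 0")
  case True
  thus ?thesis by (simp add: hyp_one_def eval_fps_at_0)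
next
  case False
  define R where "R = (\<lambda>y. y powr K * (1 + y) powr l * hyp_one K l (- y))"
  have deriv: "(R has_real_derivative K * x powr (K - 1) * (1 + x) powr (l - 1)) (at x)"
    if x: "0 < x" "x < 1" for x
  proof -
    have "\<bar>- x\<bar> < 1" using x by simp
    from hyp_one_has_derivative[OF K this, of l] obtain f' where
      f': "(hyp_one K l has_real_derivative f') (at (-x))"
        "- x * (1 + x) * f' + (K + (K + l) * x) * hyp_one K l (-x) = K"
      by auto
    have "(R has_real_derivative (K * x powr (K - 1) * (1 + x) powr l + x powr K * (l * (1 + x) powr (l - 1))) * hyp_one K l (-x) -
        x powr K * (1 + x) powr l * f') (at x)"
      unfolding R_def using x
      by (auto intro!: derivative_eq_intros DERIV_chain2[where f = "hyp_one K l" and g = uminus, OF f'(1)]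
            simp: algebra_simps)
    also have "(K * x powr (K - 1) * (1 + x) powr l + x powr K * (l * (1 + x) powr (l - 1))) * hyp_one K l (-x) -
        x powr K * (1 + x) powr l * f' = x powr (K - 1) * (1 + x) powr (l - 1) *
        (- x * (1 + x) * f' + (K + (K + l) * x) * hyp_one K l (-x))"
    proof -
      have "x powr K = x * x powr (K - 1)" "(1 + x) powr l = (1 + x) * (1 + x) powr (l - 1)"
        using x by (simp_all add: powr_mult_base)
      thus ?thesis by (simp add: algebra_simps)
    qed
    finally show ?thesis unfolding f'(2) by (simp add: mult_ac)
  qed
  have cont: "continuous_on {0..y} R"
    unfolding R_def hyp_one_def using K y
    by (intro continuous_intros continuous_on_powr' continuous_on_eval_fps' subset_trans[OF _ eball_mono[OF fps_conv_radius_hypergeo]])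
       auto
  have "R 0 \<le> R y"
  proof (rule DERIV_nonneg_imp_increasing_open[OF y(1) _ cont])
    fix x assume "0 < x" "x < y"
    thus "\<exists>d. (R has_real_derivative d) (at x) \<and> 0 \<le> d"
      using y K by (intro exI[of _ "K * x powr (K - 1) * (1 + x) powr (l - 1)"] conjI deriv) auto
  qed
  moreover have "R 0 = 0" by (simp add: R_def)
  ultimately have "0 \<le> (y powr K * (1 + y) powr l) * hyp_one K l (- y)" by (simp add: R_def)
  moreover have "y powr K * (1 + y) powr l > 0" using False y by simp
  ultimately show ?thesis by (meson mult_pos_neg not_le)
qed

text \<open>As the derivative below shows, this is \<open>K\<close> times the integral of
  \<open>(1 - exp (- u))^(K - 1) exp (- l u)\<close> over \<open>[0, s]\<close>.\<close>

definition hyp_one_int :: "real \<Rightarrow> real \<Rightarrow> real \<Rightarrow> real" where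
  "hyp_one_int K l s = (1 - exp (- s)) powr K * exp (- (l * s)) * hyp_one K l (1 - exp (- s))"

text \<open>With \<open>x = 1 - exp (- s)\<close> one has \<open>dx/ds = 1 - x\<close>, and the
  factors in front of \<open>hyp_one\<close> form an integrating factor of its differential
  equation.\<close>

lemma hyp_one_int_has_derivative:
  assumes K: "K > 0" and s: "s > 0"
  shows "(hyp_one_int K l has_real_derivative K * (1 - exp (- s)) powr (K - 1) * exp (- (l * s))) (at s)"
proof -
  define x where "x = 1 - exp (- s)"
  have x: "0 < x" "x < 1" using s by (auto simp: x_def)
  hence "\<bar>x\<bar> < 1" by simp
  from hyp_one_has_derivative[OF K this, of l] obtain f' where
    f': "(hyp_one K l has_real_derivative f') (at x)"
      "x * (1 - x) * f' + (K - (K + l) * x) * hyp_one K l x = K" .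
  have e: "exp (- s) = 1 - x" by (simp add: x_def)
  have "(hyp_one_int K l has_real_derivative
     (K * x powr (K - 1) * (1 - x) * exp (- (l * s)) - x powr K * (l * exp (- (l * s)))) * hyp_one K l x +
     x powr K * exp (- (l * s)) * (f' * (1 - x))) (at s)"
    unfolding hyp_one_int_def using x f'(1)
    by (auto intro!: derivative_eq_intros DERIV_chain2[where f = "hyp_one K l"] simp: algebra_simps simp flip: x_def)
       (simp_all add: e algebra_simps)?
  also have "(K * x powr (K - 1) * (1 - x) * exp (- (l * s)) - x powr K * (l * exp (- (l * s)))) * hyp_one K l x +
     x powr K * exp (- (l * s)) * (f' * (1 - x)) = x powr (K - 1) * exp (- (l * s)) *
     (x * (1 - x) * f' + (K - (K + l) * x) * hyp_one K l x)"
  proof -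
    have "x powr K = x * x powr (K - 1)" using x by (simp add: powr_mult_base)
    thus ?thesis by (simp add: algebra_simps)
  qed
  finally show ?thesis unfolding f'(2) by (simp add: x_def mult_ac)
qed

lemma hyp_one_int_continuous:
  assumes K: "K > 0"
  shows "continuous_on {0..} (hyp_one_int K l)"
  unfolding hyp_one_int_def hyp_one_def using K
  by (intro continuous_intros continuous_on_powr' continuous_on_eval_fps' subset_trans[OF _ eball_mono[OF fps_conv_radius_hypergeo]])
     auto

section \<open>Elementary bounds and the model function\<close>

lemma comparable_one_minus_exp:
  fixes s :: real
  assumes "s > 0"
  shows "comparable 2 (1 - exp (- s)) (s / (1 + s))"
proof -
  have "s / (1 + s) \<le> 1 - exp (- s)"
    using assms exp_ge_add_one_self[of s] by (simp add: exp_minus field_simps)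
  moreover have "1 - exp (- s) \<le> 2 * (s / (1 + s))"
  proof (cases "s \<le> 1")
    case True
    have "1 - exp (- s) \<le> s" using exp_ge_add_one_self[of "-s"] by simp
    also have "s * (1 + s) \<le> s * 2" using True assms by (intro mult_left_mono) auto
    hence "s \<le> 2 * (s / (1 + s))" using assms by (simp add: field_simps)
    finally show ?thesis .
  next
    case False
    hence "1 \<le> 2 * (s / (1 + s))" by (simp add: field_simps)
    thus ?thesis using exp_gt_zero[of "-s"] by linarith
  qed
  ultimately show ?thesis using assms by (simp add: comparable_def)
qed

text \<open>Spreading the exponential over \<open>p\<close> equal factors,
  \<open>1 + x \<le> p * exp (x / p)\<close>. The bound serves to trade \<open>exp (- l s)\<close>
  for a power of \<open>1 + l s\<close>.\<close>

lemma powr_one_plus_le_exp: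
  fixes p x :: real
  assumes "p \<ge> 1" "x \<ge> 0"
  shows "(1 + x) powr p \<le> p powr p * exp x"
proof -
  have "1 + x \<le> p * (1 + x / p)" using assms by (simp add: field_simps)
  also have "\<dots> \<le> p * exp (x / p)"
    using assms by (intro mult_left_mono exp_ge_add_one_self) auto
  finally have "(1 + x) powr p \<le> (p * exp (x / p)) powr p"
    using assms by (intro powr_mono2) auto
  also have "\<dots> = p powr p * exp x"
    using assms by (simp add: powr_mult powr_def[of "exp _"])
  finally show ?thesis .
qed

text \<open>The size of the integral of \<open>(u / (1 + u))^(K - 1)\<close> over \<open>[0, m]\<close>.\<close>

definition model_int :: "real \<Rightarrow> real \<Rightarrow> real" where
  "model_int K m = m powr K * (1 + m) powr (1 - K)"

text \<open>The derivative is \<open>(m / (1 + m))^(K - 1)\<close> times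
  \<open>(K + m) / (1 + m)\<close>, and the last factor stays between \<open>min K 1\<close> and
  \<open>max K 1\<close>. This is what makes the model usable in both estimates below.\<close>

lemma model_int_has_derivative:
  assumes "m > 0"
  shows "(model_int K has_real_derivative model_int K m * (K + m) / (m * (1 + m))) (at m)"
proof -
  have "(model_int K has_real_derivative
      K * m powr (K - 1) * (1 + m) powr (1 - K) + m powr K * ((1 - K) * (1 + m) powr (- K))) (at m)"
    unfolding model_int_def using assms by (auto intro!: derivative_eq_intros)
  also have "m powr (K - 1) = m powr K / m" using assms by (simp add: powr_diff)
  also have "(1 + m) powr (- K) = (1 + m) powr (1 - K) / (1 + m)"
    using assms powr_diff[of "1 + m" "1 - K" 1] by simp
  also have "K * (m powr K / m) * (1 + m) powr (1 - K) + m powr K * ((1 - K) * ((1 + m) powr (1 - K) / (1 + m))) =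
      m powr K * (1 + m) powr (1 - K) * (K / m + (1 - K) / (1 + m))"
    by (simp add: algebra_simps)
  also have "K / m + (1 - K) / (1 + m) = (K + m) / (m * (1 + m))"
    using assms by (simp add: field_simps)
  finally show ?thesis unfolding model_int_def by simp
qed

lemma model_int_continuous:
  assumes "K > 0"
  shows "continuous_on {0..} (model_int K)"
  unfolding model_int_def using assms by (intro continuous_intros continuous_on_powr') auto

lemma model_int_pos: "m > 0 \<Longrightarrow> model_int K m > 0"
  by (simp add: model_int_def)

lemma model_int_div: "m > 0 \<Longrightarrow> model_int K m / m = (m / (1 + m)) powr (K - 1)"
  by (simp add: model_int_def powr_divide powr_diff powr_minus field_simps)

section \<open>Two-sided estimate of the integral\<close>

text \<open>Both sides vanish at \<open>s = 0\<close>, so it suffices to compare derivatives in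
  \<open>s\<close>. The chain rule contributes \<open>1 / (1 + l s)^2\<close>, which the decay of
  \<open>exp (- l s)\<close> has to absorb.\<close>

lemma hyp_one_int_upper:
  assumes K: "K > 0"
  obtains C where "C > 0" "\<And>l s. l \<ge> 0 \<Longrightarrow> s > 0 \<Longrightarrow> hyp_one_int K l s \<le> C * model_int K (s / (1 + l * s))"
proof -
  \<comment> \<open>Of the \<open>p\<close> powers of \<open>1 / (1 + l x)\<close> gained from the
    exponential, two match the derivative of \<open>m\<close>, and \<open>\<bar>K - 1\<bar>\<close>
    pay for replacing \<open>x / (1 + x)\<close> by \<open>m x / (1 + m x)\<close>, which differ by
    a factor of at most \<open>1 + l x\<close>.\<close>
  define p where "p = \<bar>K - 1\<bar> + 2"
  define C where "C = K * 2 powr \<bar>K - 1\<bar> * p powr p / min K 1"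
  have C: "C > 0" using K by (simp add: C_def p_def)
  have "hyp_one_int K l s \<le> C * model_int K (s / (1 + l * s))" if l: "l \<ge> 0" and s: "s > 0" for l s
  proof -
    define m where "m = (\<lambda>s. s / (1 + l * s))"
    define D where "D = (\<lambda>s. C * model_int K (m s) - hyp_one_int K l s)"
    have deriv: "\<exists>d. (D has_real_derivative d) (at x) \<and> d \<ge> 0" if x: "x > 0" for x
    proof -
      have lx: "1 + l * x > 0" using l x by (simp add: add_pos_nonneg)
      have mx: "m x > 0" using x lx by (simp add: m_def)
      have "(m has_real_derivative 1 / (1 + l * x)\<^sup>2) (at x)"
        unfolding m_def using lx by (auto intro!: derivative_eq_intros simp: field_simps power2_eq_square)
      note chain = DERIV_chain2[OF model_int_has_derivative[OF mx, of K] this]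
      have D: "(D has_real_derivative C * (model_int K (m x) * (K + m x) / (m x * (1 + m x)) * (1 / (1 + l * x)\<^sup>2)) -
          K * (1 - exp (- x)) powr (K - 1) * exp (- (l * x))) (at x)"
        unfolding D_def by (intro DERIV_diff DERIV_cmult chain hyp_one_int_has_derivative K x)
      have "K * (1 - exp (- x)) powr (K - 1) * exp (- (l * x)) \<le>
          K * (2 powr \<bar>K - 1\<bar> * (x / (1 + x)) powr (K - 1)) * (p powr p / (1 + l * x) powr p)"
      proof (intro mult_mono)
        show "(1 - exp (- x)) powr (K - 1) \<le> 2 powr \<bar>K - 1\<bar> * (x / (1 + x)) powr (K - 1)"
          using comparable_powr[OF comparable_one_minus_exp[OF x], of "K - 1"] by (simp add: comparable_def)
        show "exp (- (l * x)) \<le> p powr p / (1 + l * x) powr p"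
          using powr_one_plus_le_exp[of p "l * x"] l x lx by (simp add: p_def exp_minus field_simps)
      qed (use K in auto)
      also have "\<dots> \<le> K * (2 powr \<bar>K - 1\<bar> * ((1 + l * x) powr \<bar>K - 1\<bar> * (x / (1 + x + l * x)) powr (K - 1))) *
          (p powr p / (1 + l * x) powr p)"
      proof (intro mult_right_mono mult_left_mono)
        have "comparable (1 + l * x) (x / (1 + x)) (x / (1 + x + l * x))"
        proof -
          have "1 + (x + l * x) > 0" using x l by (simp add: add_pos_nonneg)
          thus ?thesis using x l by (auto simp: comparable_def field_simps)
        qed
        from comparable_powr[OF this, of "K - 1"]
        show "(x / (1 + x)) powr (K - 1) \<le> (1 + l * x) powr \<bar>K - 1\<bar> * (x / (1 + x + l * x)) powr (K - 1)"
          by (simp add: comparable_def)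
      qed (use K in auto)
      also have "x / (1 + x + l * x) = m x / (1 + m x)"
      proof -
        have "1 + m x = (1 + x + l * x) / (1 + l * x)" using lx by (simp add: m_def field_simps)
        thus ?thesis using lx by (simp add: m_def)
      qed
      also have "K * (2 powr \<bar>K - 1\<bar> * ((1 + l * x) powr \<bar>K - 1\<bar> * (m x / (1 + m x)) powr (K - 1))) * (p powr p / (1 + l * x) powr p) =
          C * (min K 1 * (m x / (1 + m x)) powr (K - 1) * (1 / (1 + l * x)\<^sup>2))"
        using K lx by (simp add: C_def p_def powr_add field_simps)
      also have "min K 1 * (m x / (1 + m x)) powr (K - 1) = (model_int K (m x) * min K 1) / m x"
        using mx by (simp add: model_int_div[symmetric])
      also have "C * (model_int K (m x) * min K 1 / m x * (1 / (1 + l * x)\<^sup>2)) \<le>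
          C * (model_int K (m x) * (K + m x) / (m x * (1 + m x)) * (1 / (1 + l * x)\<^sup>2))"
      proof (intro mult_left_mono mult_right_mono)
        have "min K 1 * (1 + m x) \<le> K + m x"
          using K mx by (auto simp: min_def algebra_simps mult_left_le)
        hence "model_int K (m x) * (min K 1 * (1 + m x)) / (m x * (1 + m x)) \<le> model_int K (m x) * (K + m x) / (m x * (1 + m x))"
          using mx model_int_pos[OF mx, of K] by (intro divide_right_mono mult_left_mono) auto
        thus "model_int K (m x) * min K 1 / m x \<le> model_int K (m x) * (K + m x) / (m x * (1 + m x))"
          using mx by simp
      qed (use C in auto)
      finally show ?thesis using D by (intro exI conjI) auto
    qed
    have nz: "1 + l * x > 0" if "x \<in> {0..s}" for x
      using l that by (auto intro: add_pos_nonneg)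
    have "continuous_on {0..s} m"
      unfolding m_def by (intro continuous_intros ballI) (use nz in \<open>metis less_irrefl\<close>)
    moreover have "m ` {0..s} \<subseteq> {0..}"
      by (auto simp: m_def intro!: divide_nonneg_nonneg less_imp_le[OF nz])
    ultimately have "continuous_on {0..s} (\<lambda>x. model_int K (m x))"
      by (rule continuous_on_compose2[OF model_int_continuous[OF K]])
    hence cont: "continuous_on {0..s} D"
      unfolding D_def
      by (intro continuous_intros continuous_on_subset[OF hyp_one_int_continuous[OF K]]) auto
    have "D 0 \<le> D s"
      by (rule DERIV_nonneg_imp_increasing_open[of 0 s D]) (use s cont deriv in auto)
    moreover have "D 0 = 0" by (simp add: D_def m_def model_int_def hyp_one_int_def)
    ultimately show ?thesis by (simp add: D_def m_def)
  qed
  with C that show ?thesis by blast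
qed

text \<open>Up to \<open>m = s / (1 + l * s)\<close> the exponential factor is at least
  \<open>exp (- 1)\<close>, so the derivatives can be compared on \<open>[0, m]\<close>. From
  \<open>m\<close> to \<open>s\<close> the integral only grows.\<close>

lemma hyp_one_int_lower:
  assumes K: "K > 0"
  obtains c where "c > 0" "\<And>l s. l \<ge> 0 \<Longrightarrow> s > 0 \<Longrightarrow> c * model_int K (s / (1 + l * s)) \<le> hyp_one_int K l s"
proof -
  \<comment> \<open>The denominator collects the losses from the bound \<open>max K 1\<close> in the
    derivative of the model and from replacing \<open>x / (1 + x)\<close> by
    \<open>1 - exp (- x)\<close>.\<close>
  define c where "c = K * exp (- 1) / (2 powr \<bar>K - 1\<bar> * max K 1)"
  have c: "c > 0" using K by (simp add: c_def)
  have "c * model_int K (s / (1 + l * s)) \<le> hyp_one_int K l s" if l: "l \<ge> 0" and s: "s > 0" for l s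
  proof -
    define m where "m = s / (1 + l * s)"
    have ls: "1 + l * s > 0" using l s by (simp add: add_pos_nonneg)
    have m: "m > 0" "m \<le> s" "l * m \<le> 1" using ls l s by (auto simp: m_def field_simps)
    define D where "D = (\<lambda>s. hyp_one_int K l s - c * model_int K s)"
    have deriv: "\<exists>d. (D has_real_derivative d) (at x) \<and> d \<ge> 0" if x: "0 < x" "x < m" for x
    proof -
      have D: "(D has_real_derivative K * (1 - exp (- x)) powr (K - 1) * exp (- (l * x)) -
          c * (model_int K x * (K + x) / (x * (1 + x)))) (at x)"
        unfolding D_def by (intro DERIV_diff DERIV_cmult model_int_has_derivative hyp_one_int_has_derivative K x)
      have "model_int K x * (K + x) / (x * (1 + x)) \<le> model_int K x * (max K 1 * (1 + x)) / (x * (1 + x))"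
      proof -
        have "K + x \<le> max K 1 * (1 + x)"
          using K x by (auto simp: max_def algebra_simps mult_left_le)
        thus ?thesis using x model_int_pos[of x K] by (intro divide_right_mono mult_left_mono) auto
      qed
      also have "\<dots> = max K 1 * (x / (1 + x)) powr (K - 1)"
        using x by (simp add: model_int_div[symmetric])
      also have "\<dots> \<le> max K 1 * (2 powr \<bar>K - 1\<bar> * (1 - exp (- x)) powr (K - 1))"
        using comparable_powr[OF comparable_one_minus_exp[OF x(1)], of "K - 1"]
        by (intro mult_left_mono) (auto simp: comparable_def)
      finally have "c * (model_int K x * (K + x) / (x * (1 + x))) \<le>
          c * (max K 1 * (2 powr \<bar>K - 1\<bar> * (1 - exp (- x)) powr (K - 1)))"
        using c by (intro mult_left_mono) auto
      also have "\<dots> = K * (1 - exp (- x)) powr (K - 1) * exp (- 1)"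
        using K by (simp add: c_def max_def)
      also have "\<dots> \<le> K * (1 - exp (- x)) powr (K - 1) * exp (- (l * x))"
      proof -
        have "l * x \<le> l * m" using x l by (intro mult_left_mono) auto
        thus ?thesis using m K by (intro mult_left_mono) auto
      qed
      finally show ?thesis using D by (intro exI conjI) auto
    qed
    have cont: "continuous_on {0..m} D"
      unfolding D_def
      by (intro continuous_intros continuous_on_subset[OF hyp_one_int_continuous[OF K]]
            continuous_on_subset[OF model_int_continuous[OF K]]) auto
    have "D 0 \<le> D m"
      by (rule DERIV_nonneg_imp_increasing_open[of 0 m D]) (use m cont deriv in auto)
    moreover have "D 0 = 0" by (simp add: D_def model_int_def hyp_one_int_def)
    ultimately have "c * model_int K m \<le> hyp_one_int K l m" by (simp add: D_def)
    also have "\<dots> \<le> hyp_one_int K l s"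
    proof (rule DERIV_nonneg_imp_increasing_open[where f = "hyp_one_int K l"])
      show "\<exists>y. (hyp_one_int K l has_real_derivative y) (at x) \<and> 0 \<le> y" if "m < x" "x < s" for x
        using that m K
        by (intro exI[of _ "K * (1 - exp (- x)) powr (K - 1) * exp (- (l * x))"] conjI
              hyp_one_int_has_derivative) auto
      show "continuous_on {m..s} (hyp_one_int K l)"
        using m by (intro continuous_on_subset[OF hyp_one_int_continuous[OF K]]) auto
    qed (use m in auto)
    finally show ?thesis by (simp add: m_def)
  qed
  with c that show ?thesis by blast
qed

lemma hyp_one_int_comparable:
  assumes K: "K > 0"
  obtains C where "\<And>l s. l \<ge> 0 \<Longrightarrow> s > 0 \<Longrightarrow> comparable C (hyp_one_int K l s) (model_int K (s / (1 + l * s)))"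
proof -
  obtain C where C: "C > 0" "\<And>l s. l \<ge> 0 \<Longrightarrow> s > 0 \<Longrightarrow> hyp_one_int K l s \<le> C * model_int K (s / (1 + l * s))"
    using hyp_one_int_upper[OF K] by blast
  obtain c where c: "c > 0" "\<And>l s. l \<ge> 0 \<Longrightarrow> s > 0 \<Longrightarrow> c * model_int K (s / (1 + l * s)) \<le> hyp_one_int K l s"
    using hyp_one_int_lower[OF K] by blast
  have "comparable (max C (1 / c)) (hyp_one_int K l s) (model_int K (s / (1 + l * s)))" if ls: "l \<ge> 0" "s > 0" for l s
  proof -
    define g h where "g = model_int K (s / (1 + l * s))" and "h = hyp_one_int K l s"
    have g: "g > 0" unfolding g_def using ls by (intro model_int_pos) (simp add: add_pos_nonneg)
    have gh: "h \<le> C * g" "c * g \<le> h" using C(2)[OF ls] c(2)[OF ls] by (auto simp: g_def h_def)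
    have h: "h > 0" using gh(2) c(1) g by (meson less_le_trans mult_pos_pos)
    have "h \<le> max C (1 / c) * g" using gh(1) g mult_right_mono[of C "max C (1 / c)" g] by linarith
    moreover have "g \<le> 1 / c * h" using gh(2) c(1) by (simp add: field_simps)
    hence "g \<le> max C (1 / c) * h" using h mult_right_mono[of "1 / c" "max C (1 / c)" h] by linarith
    ultimately show ?thesis using g h by (simp add: comparable_def flip: g_def h_def)
  qed
  with that show ?thesis by blast
qed

section \<open>Reduction of the transformed series to \<open>hyp_one\<close>\<close>

lemma hyp_one_sums:
  assumes "\<bar>y\<bar> < 1"
  shows "(\<lambda>n. pochhammer (K + l) n / pochhammer (K + 1) n * y ^ n) sums hyp_one K l y"
  using sums_eval_fps[of y "fps_hypergeo [K + l, 1] [K + 1] 1"]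
    norm_less_conv_radius_hypergeo[of y "K + l" 1 "K + 1"] assms
  by (simp add: hyp_one_def flip: pochhammer_fact)

lemma hyp_one_even_part:
  assumes x: "\<bar>x\<bar> < 1"
  shows "(\<lambda>n. pochhammer (K + l) (2 * n) / pochhammer (K + 1) (2 * n) * (x\<^sup>2) ^ n) sums
    ((hyp_one K l x + hyp_one K l (- x)) / 2)"
proof -
  define d where "d = (\<lambda>n. pochhammer (K + l) n / pochhammer (K + 1) n)"
  have s: "(\<lambda>n. d n * y ^ n) sums hyp_one K l y" if "\<bar>y\<bar> < 1" for y
    using hyp_one_sums[OF that] by (simp add: d_def)
  have "(\<lambda>n. (d n * x ^ n + d n * (- x) ^ n) / 2) sums ((hyp_one K l x + hyp_one K l (- x)) / 2)"
    using x by (intro sums_divide sums_add s) auto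
  also have "?this \<longleftrightarrow> (\<lambda>n. (d (2 * n) * x ^ (2 * n) + d (2 * n) * (- x) ^ (2 * n)) / 2) sums
      ((hyp_one K l x + hyp_one K l (- x)) / 2)"
  proof (rule sums_mono_reindex[symmetric])
    show "strict_mono (\<lambda>n::nat. 2 * n)" by (simp add: strict_mono_def)
    show "(d n * x ^ n + d n * (- x) ^ n) / 2 = 0" if "n \<notin> range (\<lambda>n. 2 * n)" for n
    proof -
      have "odd n" using that by (auto elim!: evenE)
      thus ?thesis by simp
    qed
  qed
  also have "(\<lambda>n. (d (2 * n) * x ^ (2 * n) + d (2 * n) * (- x) ^ (2 * n)) / 2) = (\<lambda>n. d (2 * n) * (x\<^sup>2) ^ n)"
    by (simp add: power_mult fun_eq_iff)
  finally show ?thesis by (simp only: d_def)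
qed

lemma comparable_sums:
  assumes "\<And>n. comparable C (a n) (b n)" "a sums A" "b sums B"
  shows "comparable C A B"
proof -
  have "A > 0" "B > 0"
    using assms by (auto simp: comparable_def sums_iff intro!: suminf_pos)
  moreover have "A \<le> C * B"
    by (rule sums_le[OF _ assms(2) sums_mult[OF assms(3)]]) (use assms(1) in \<open>simp add: comparable_def\<close>)
  moreover have "B \<le> C * A"
    by (rule sums_le[OF _ assms(3) sums_mult[OF assms(2)]]) (use assms(1) in \<open>simp add: comparable_def\<close>)
  ultimately show ?thesis by (simp add: comparable_def)
qed

text \<open>The duplication formula splits \<open>pochhammer (K + l) (2 * n)\<close> and
  \<open>pochhammer (K + 1) (2 * n)\<close> into products of two symbols of length \<open>n\<close>;
  the powers of 4 cancel. Numerators and denominators then match termwise up to constants because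
  the sums of their parameters agree: \<open>K + 1 / 2\<close> above, with common shift
  \<open>l / 2\<close>, and \<open>K + 3 / 2\<close> below, with shift 0.\<close>

lemma hypergeo_comparable_hyp_one:
  assumes k: "k1 > 0" "k2 > 0"
  obtains C where "\<And>l x. l \<ge> 0 \<Longrightarrow> 0 < x \<Longrightarrow> x < 1 \<Longrightarrow>
    comparable C (eval_fps (fps_hypergeo [(k1 + 2 * k2 + l) / 2, (k1 + 1 + l) / 2] [k1 + k2 + 1 / 2] 1) (x\<^sup>2))
      ((hyp_one (k1 + k2) l x + hyp_one (k1 + k2) l (- x)) / 2)"
proof -
  define K where "K = k1 + k2"
  have K: "K > 0" using k by (simp add: K_def)
  obtain C1 where C1: "\<And>\<mu> n. \<mu> \<ge> 0 \<Longrightarrow>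
      comparable C1 (pochhammer ((k1 + 2 * k2) / 2 + \<mu>) n * pochhammer ((k1 + 1) / 2 + \<mu>) n)
        (pochhammer (K / 2 + \<mu>) n * pochhammer ((K + 1) / 2 + \<mu>) n)"
    by (rule pochhammer_mult_comparable[of "(k1 + 2 * k2) / 2" "(k1 + 1) / 2" "K / 2" "(K + 1) / 2"])
       (use k in \<open>auto simp: K_def field_simps\<close>)
  obtain C2 where C2: "\<And>\<mu> n. \<mu> \<ge> 0 \<Longrightarrow>
      comparable C2 (pochhammer (K + 1 / 2 + \<mu>) n * pochhammer (1 + \<mu>) n)
        (pochhammer ((K + 1) / 2 + \<mu>) n * pochhammer ((K + 1) / 2 + 1 / 2 + \<mu>) n)"
    by (rule pochhammer_mult_comparable[of "K + 1 / 2" 1 "(K + 1) / 2" "(K + 1) / 2 + 1 / 2"])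
       (use K in \<open>auto simp: field_simps\<close>)
  have "comparable (C1 * C2 * 1)
      (eval_fps (fps_hypergeo [(k1 + 2 * k2 + l) / 2, (k1 + 1 + l) / 2] [k1 + k2 + 1 / 2] 1) (x\<^sup>2))
      ((hyp_one K l x + hyp_one K l (- x)) / 2)" if l: "l \<ge> 0" and x: "0 < x" "x < 1" for l x
  proof (rule comparable_sums)
    let ?f = "fps_hypergeo [(k1 + 2 * k2 + l) / 2, (k1 + 1 + l) / 2] [k1 + k2 + 1 / 2] 1 :: real fps"
    have "norm (x\<^sup>2) < 1" using x by (simp add: abs_square_less_1)
    thus "(\<lambda>n. ?f $ n * (x\<^sup>2) ^ n) sums eval_fps ?f (x\<^sup>2)"
      by (intro sums_eval_fps norm_less_conv_radius_hypergeo)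
    show "(\<lambda>n. pochhammer (K + l) (2 * n) / pochhammer (K + 1) (2 * n) * (x\<^sup>2) ^ n) sums
        ((hyp_one K l x + hyp_one K l (- x)) / 2)"
      using x by (intro hyp_one_even_part) auto
    show "comparable (C1 * C2 * 1) (?f $ n * (x\<^sup>2) ^ n)
        (pochhammer (K + l) (2 * n) / pochhammer (K + 1) (2 * n) * (x\<^sup>2) ^ n)" for n
    proof (rule comparable_mult)
      have "?f $ n = pochhammer ((k1 + 2 * k2) / 2 + l / 2) n * pochhammer ((k1 + 1) / 2 + l / 2) n /
          (pochhammer (K + 1 / 2 + 0) n * pochhammer (1 + 0) n)"
        by (simp add: K_def add_divide_distrib flip: pochhammer_fact)
      moreover have "pochhammer (K + l) (2 * n) / pochhammer (K + 1) (2 * n) =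
          (pochhammer (K / 2 + l / 2) n * pochhammer ((K + 1) / 2 + l / 2) n) /
          (pochhammer ((K + 1) / 2 + 0) n * pochhammer ((K + 1) / 2 + 1 / 2 + 0) n)"
        using pochhammer_double[of "(K + l) / 2" n] pochhammer_double[of "(K + 1) / 2" n]
        by (simp add: add_divide_distrib add_ac)
      ultimately show "comparable (C1 * C2) (?f $ n) (pochhammer (K + l) (2 * n) / pochhammer (K + 1) (2 * n))"
        using comparable_divide[OF C1[of "l / 2" n] C2[of 0 n]] l by simp
      show "comparable 1 ((x\<^sup>2) ^ n) ((x\<^sup>2) ^ n)"
        using x by (intro comparable_refl) auto
    qed
  qed
  thus ?thesis unfolding K_def by (rule that)
qed

text \<open>The coefficients are nonnegative, so \<open>hyp_one K l (- x)\<close> lies between 0 and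
  \<open>hyp_one K l x\<close>, and the mean of the two is at least half the larger one.\<close>

lemma hyp_one_even_part_comparable:
  assumes K: "K > 0" and l: "l \<ge> 0" and x: "0 \<le> x" "x < 1" and pos: "hyp_one K l x > 0"
  shows "comparable 2 ((hyp_one K l x + hyp_one K l (- x)) / 2) (hyp_one K l x)"
proof -
  have "hyp_one K l (- x) \<le> hyp_one K l x"
  proof (rule sums_le[OF _ hyp_one_sums hyp_one_sums])
    fix n
    have "(- x) ^ n \<le> x ^ n" using x by (cases "even n") auto
    thus "pochhammer (K + l) n / pochhammer (K + 1) n * (- x) ^ n \<le> pochhammer (K + l) n / pochhammer (K + 1) n * x ^ n"
      using K l by (intro mult_left_mono divide_nonneg_nonneg pochhammer_nonneg) auto
  qed (use x in auto)
  thus ?thesis using hyp_one_minus_nonneg[OF K x, of l] pos by (simp add: comparable_def)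
qed

lemma eval_fps_hypergeo_of_real:
  assumes "\<bar>x\<bar> < 1"
  shows "eval_fps (fps_hypergeo [of_real a, of_real b] [of_real c] 1) (complex_of_real x) =
    of_real (eval_fps (fps_hypergeo [a, b] [c] 1) x)"
proof -
  have "(\<lambda>n. fps_hypergeo [a, b] [c] 1 $ n * x ^ n) sums eval_fps (fps_hypergeo [a, b] [c] 1) x"
    using assms by (intro sums_eval_fps norm_less_conv_radius_hypergeo) auto
  hence "(\<lambda>n. complex_of_real (fps_hypergeo [a, b] [c] 1 $ n * x ^ n)) sums
      of_real (eval_fps (fps_hypergeo [a, b] [c] 1) x)"
    by (rule sums_of_real)
  thus ?thesis by (simp add: eval_fps_def sums_iff pochhammer_of_real)
qed

text \<open>With \<open>A\<close>, \<open>L\<close>, \<open>E\<close> as below, replacing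
  \<open>x\<close> by \<open>s / A\<close> turns the left side into exactly
  \<open>A / L^K * (A L / E)^(K - 1)\<close>, and each of the three bases is within a factor 2 of
  its counterpart in \<open>BC1_bound\<close>.\<close>

lemma model_comparable:
  assumes l: "l \<ge> 0" and s: "0 < s" and t: "t \<le> s" "s \<le> 2 * t" and x: "comparable 2 x (s / (1 + s))"
  shows "comparable (2 powr \<bar>K\<bar> * (2 * 2 powr \<bar>K\<bar> * 2 powr \<bar>K - 1\<bar>))
    (x powr (- K) * model_int K (s / (1 + l * s)))
    ((1 + t) / (1 + l * t) powr K * ((1 + l * (1 + t)) / (1 + l)) powr (K - 1))"
proof -
  define A L E where "A = 1 + s" and "L = 1 + l * s" and "E = 1 + s + l * s"
  have t0: "t > 0" using s t by auto
  have pos: "A > 0" "L > 0" "E > 0" using l s by (auto simp: A_def L_def E_def intro: add_pos_nonneg)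
  have m: "s / L > 0" using s pos by simp
  have c1: "comparable (2 powr \<bar>K\<bar> * 1) (x powr (- K) * model_int K (s / L)) ((s / A) powr (- K) * model_int K (s / L))"
    using comparable_powr[OF x, of "- K"] comparable_refl[OF model_int_pos[OF m, of K]]
    by (intro comparable_mult) (auto simp: A_def)
  have eq: "(s / A) powr (- K) * model_int K (s / L) = A / L powr K * (A * L / E) powr (K - 1)"
  proof -
    have "1 + s / L = E / L" using pos by (simp add: field_simps E_def L_def)
    thus ?thesis using pos s
      by (simp add: model_int_def powr_divide powr_mult powr_diff powr_minus field_simps)
  qed
  have c2: "comparable (2 * 2 powr \<bar>K\<bar> * 2 powr \<bar>K - 1\<bar>) (A / L powr K * (A * L / E) powr (K - 1))
    ((1 + t) / (1 + l * t) powr K * ((1 + l * (1 + t)) / (1 + l)) powr (K - 1))"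
  proof (intro comparable_mult comparable_divide comparable_powr)
    show "comparable 2 A (1 + t)" using t t0 by (auto simp: A_def comparable_def)
    have "l * t \<le> l * s" "l * s \<le> l * (2 * t)" using t l by (auto intro!: mult_left_mono)
    note lst = this
    have lt: "l * t \<ge> 0" using l t0 by simp
    show "comparable 2 L (1 + l * t)" using lst lt by (auto simp: L_def comparable_def)
    \<comment> \<open>This says that \<open>(1 + l (1 + s)) / (1 + l)\<close> exceeds
      \<open>A L / E\<close> only through the term \<open>l * s\<close>, which is itself at most
      \<open>A L (1 + l)\<close>.\<close>
    have id: "(1 + l + l * s) * E = A * L * (1 + l) + l * s"
      by (simp add: A_def L_def E_def algebra_simps)
    have ls: "l * s \<ge> 0" using l s by simp
    have "(1 + l * (1 + t)) * E \<le> (1 + l + l * s) * E"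
      using lst pos by (intro mult_right_mono) (auto simp: algebra_simps)
    also have "\<dots> \<le> 2 * (A * L) * (1 + l)"
    proof -
      have "l * s \<le> L" by (simp add: L_def)
      also have "L * 1 \<le> L * (A * (1 + l))"
        using pos s l by (intro mult_left_mono) (auto simp: A_def algebra_simps add_nonneg_nonneg)
      finally show ?thesis unfolding id by (simp add: algebra_simps)
    qed
    finally have 1: "(1 + l * (1 + t)) / (1 + l) \<le> 2 * (A * L / E)"
      using pos l by (simp add: field_simps)
    have "A * L * (1 + l) \<le> (1 + l + l * s) * E" unfolding id using ls by simp
    also have "\<dots> \<le> (2 * (1 + l * (1 + t))) * E"
      using lst l pos by (intro mult_right_mono) (auto simp: algebra_simps)
    finally have 2: "A * L / E \<le> 2 * ((1 + l * (1 + t)) / (1 + l))"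
      using pos l by (simp add: field_simps)
    show "comparable 2 (A * L / E) ((1 + l * (1 + t)) / (1 + l))"
      using 1 2 pos l t0 by (auto simp: comparable_def intro!: divide_pos_pos add_pos_nonneg)
  qed
  from comparable_trans[OF c1 c2[folded eq]] show ?thesis
    by (simp only: L_def mult_1_right)
qed

section \<open>The bound\<close>

text \<open>Pfaff's transformation at \<open>z = - sinh^2 t\<close>, where
  \<open>1 - z = cosh^2 t\<close> and \<open>z / (z - 1) = tanh^2 t\<close>. The result shows that
  the value is real.\<close>

lemma BC1_phi_eq:
  assumes k: "k1 > 0" "k2 > 0" and t: "t \<ge> 0"
  shows "BC1_phi k1 k2 (of_real l) t = of_real (cosh t powr (- (k1 + 2 * k2 + l)) *
    eval_fps (fps_hypergeo [(k1 + 2 * k2 + l) / 2, (k1 + 1 + l) / 2] [k1 + k2 + 1 / 2] 1) ((tanh t)\<^sup>2))"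
proof -
  define a b c where "a = (k1 + 2 * k2 + l) / 2" and "b = (k1 + 2 * k2 - l) / 2" and "c = k1 + k2 + 1 / 2"
  define F where "F = hyp2F1 (of_real a) (of_real b) (of_real c)"
  define z where "z = complex_of_real (- (sinh t)\<^sup>2)"
  have c: "c > 0" using k by (simp add: c_def)
  have F: "hypergeo_continuation (of_real a) (of_real b) (of_real c) F"
    using someI_ex[OF hypergeo_continuation_exists[OF c, of "of_real a" b]]
    unfolding F_def hyp2F1_def hypergeo_continuation_def .
  have ch: "1 + (sinh t)\<^sup>2 = (cosh t)\<^sup>2" "cosh t > 0"
    by (simp_all add: cosh_square_eq add.commute)
  have "BC1_phi k1 k2 (of_real l) t = F z"
    by (simp add: BC1_phi_def BC1_rho_def F_def a_def b_def c_def z_def)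
  also have "\<dots> = (1 - z) powr (- of_real a) *
      eval_fps (fps_hypergeo [of_real a, of_real c - of_real b] [of_real c] 1) (z / (z - 1))"
    by (intro hypergeo_continuation_pfaff[OF F] of_real_pos_not_nonpos_Ints c)
       (use zero_le_power2[of "sinh t"] in \<open>simp add: z_def; linarith\<close>)
  also have "1 - z = of_real ((cosh t)\<^sup>2)"
    unfolding z_def ch(1)[symmetric] by simp
  also have "of_real ((cosh t)\<^sup>2) powr (- of_real a) = complex_of_real ((cosh t)\<^sup>2 powr (- a))"
    by (subst powr_of_real [symmetric]) auto
  also have "(cosh t)\<^sup>2 powr (- a) = cosh t powr (- (k1 + 2 * k2 + l))"
  proof -
    have "(cosh t)\<^sup>2 powr (- a) = cosh t powr (2 * (- a))"
      using ch(2) by (simp add: powr_powr flip: powr_numeral)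
    also have "2 * (- a) = - (k1 + 2 * k2 + l)" by (simp add: a_def field_simps)
    finally show ?thesis .
  qed
  also have "z / (z - 1) = of_real ((tanh t)\<^sup>2)"
  proof -
    have "z - 1 = - of_real ((cosh t)\<^sup>2)" unfolding z_def ch(1)[symmetric] by simp
    thus ?thesis by (simp add: z_def tanh_def power_divide)
  qed
  also have "complex_of_real c - of_real b = of_real ((k1 + 1 + l) / 2)"
    by (simp add: c_def b_def field_simps)
  also have "eval_fps (fps_hypergeo [of_real a, of_real ((k1 + 1 + l) / 2)] [of_real c] 1) (complex_of_real ((tanh t)\<^sup>2)) =
      of_real (eval_fps (fps_hypergeo [a, (k1 + 1 + l) / 2] [c] 1) ((tanh t)\<^sup>2))"
    using tanh_real_bounds[of t] by (intro eval_fps_hypergeo_of_real) (simp add: abs_square_less_1 abs_less_iff)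
  finally show ?thesis by (simp add: a_def c_def)
qed

lemma BC1_comparable_pos:
  assumes k: "k1 > 0" "k2 > 0"
  obtains C where "\<And>l t. l \<ge> 0 \<Longrightarrow> t > 0 \<Longrightarrow> comparable C (Re (BC1_phi k1 k2 (of_real l) t)) (BC1_bound k1 k2 l t)"
proof -
  define K where "K = k1 + k2"
  define \<rho> where "\<rho> = k1 + 2 * k2"
  have K: "K > 0" using k by (simp add: K_def)
  obtain C1 where C1: "\<And>l x. l \<ge> 0 \<Longrightarrow> 0 < x \<Longrightarrow> x < 1 \<Longrightarrow>
    comparable C1 (eval_fps (fps_hypergeo [(\<rho> + l) / 2, (k1 + 1 + l) / 2] [K + 1 / 2] 1) (x\<^sup>2))
      ((hyp_one K l x + hyp_one K l (- x)) / 2)"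
    unfolding K_def \<rho>_def using hypergeo_comparable_hyp_one[OF k] by metis
  obtain C2 where C2: "\<And>l s. l \<ge> 0 \<Longrightarrow> s > 0 \<Longrightarrow> comparable C2 (hyp_one_int K l s) (model_int K (s / (1 + l * s)))"
    using hyp_one_int_comparable[OF K] by metis
  define C3 where "C3 = 2 powr \<bar>K\<bar> * (2 * 2 powr \<bar>K\<bar> * 2 powr \<bar>K - 1\<bar>)"
  \<comment> \<open>The bracketing of the constant records how the comparisons are multiplied and
    chained at the end; the factors 1 come from reflexivity.\<close>
  have "comparable (1 * (C1 * 2) * (2 powr \<bar>- \<rho>\<bar> * 1 * ((1 * C2) * C3))) (Re (BC1_phi k1 k2 (of_real l) t)) (BC1_bound k1 k2 l t)"
    if l: "l \<ge> 0" and t: "t > 0" for l t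
  proof -
    \<comment> \<open>Chosen so that \<open>exp (- s) = exp (- t) / cosh t = 1 - tanh t\<close>,
      which is the substitution in \<open>hyp_one_int\<close> at \<open>x = tanh t\<close>.\<close>
    define s where "s = t + ln (cosh t)"
    define x where "x = tanh t"
    have ch: "cosh t \<ge> 1" "cosh t > 0" by (auto simp: cosh_real_ge_1)
    have ch_le: "cosh t \<le> exp t"
      using t by (simp add: cosh_def)
    have ln: "ln (cosh t) \<ge> 0" "ln (cosh t) \<le> t"
      using ch ln_mono[OF ch_le ch(2)] by (auto simp: ln_ge_zero)
    have s: "t \<le> s" "s \<le> 2 * t" "s > 0" unfolding s_def using ln t by linarith+
    have es: "exp (c * s) = exp (c * t) * cosh t powr c" for c
      using ch by (simp add: s_def powr_def exp_add distrib_left)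
    have x_eq: "x = 1 - exp (- s)"
    proof -
      have "exp (- s) = exp (- t) / cosh t"
        using es[of "-1"] ch by (simp add: powr_minus divide_inverse)
      also have "exp (- t) = cosh t - sinh t" by (simp add: cosh_minus_sinh)
      finally show ?thesis using ch by (simp add: x_def tanh_def diff_divide_distrib)
    qed
    have x: "0 < x" "x < 1" using s(3) by (auto simp: x_eq)
    have xs: "comparable 2 x (s / (1 + s))" unfolding x_eq by (rule comparable_one_minus_exp) fact
    have Q: "hyp_one K l x = x powr (- K) * exp (l * s) * hyp_one_int K l s"
      using x unfolding hyp_one_int_def x_eq[symmetric]
      by (simp add: powr_minus exp_minus field_simps)
    note cQ = C2[OF l s(3)]
    have f_pos: "hyp_one K l x > 0" unfolding Q using x cQ by (simp add: comparable_def)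
    have c1: "comparable (1 * (C1 * 2)) (Re (BC1_phi k1 k2 (of_real l) t)) (cosh t powr (- (\<rho> + l)) * hyp_one K l x)"
      unfolding BC1_phi_eq[OF k less_imp_le[OF t]] Re_complex_of_real K_def[symmetric] \<rho>_def[symmetric] x_def[symmetric]
      using x l ch K f_pos
      by (intro comparable_mult comparable_refl comparable_trans[OF C1 hyp_one_even_part_comparable]) auto
    \<comment> \<open>Since \<open>exp (l * s) = exp (l * t) * cosh t powr l\<close>, the power of
      \<open>cosh t\<close> depending on \<open>l\<close> cancels and only
      \<open>exp (l * t)\<close> remains.\<close>
    have eq1: "cosh t powr (- (\<rho> + l)) * hyp_one K l x =
        cosh t powr (- \<rho>) * exp (l * t) * (x powr (- K) * hyp_one_int K l s)"
      unfolding Q es using ch by (simp add: powr_diff powr_minus field_simps)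
    have "comparable (2 powr \<bar>- \<rho>\<bar>) (cosh t powr (- \<rho>)) (exp t powr (- \<rho>))"
    proof (rule comparable_powr)
      have "exp t \<le> 2 * cosh t" by (simp add: cosh_def)
      thus "comparable 2 (cosh t) (exp t)" using ch ch_le exp_gt_zero[of t] by (simp add: comparable_def)
    qed
    hence c2: "comparable (2 powr \<bar>- \<rho>\<bar> * 1) (cosh t powr (- \<rho>) * exp (l * t)) (exp ((l - \<rho>) * t))"
      using comparable_mult[OF _ comparable_refl[of "exp (l * t)"], of "2 powr \<bar>- \<rho>\<bar>" "cosh t powr (- \<rho>)" "exp t powr (- \<rho>)"]
      by (simp add: powr_def left_diff_distrib exp_diff exp_minus field_simps)
    have c3: "comparable (1 * C2) (x powr (- K) * hyp_one_int K l s) (x powr (- K) * model_int K (s / (1 + l * s)))"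
      using x by (intro comparable_mult comparable_refl cQ) auto
    have c4: "comparable C3 (x powr (- K) * model_int K (s / (1 + l * s)))
        ((1 + t) / (1 + l * t) powr K * ((1 + l * (1 + t)) / (1 + l)) powr (K - 1))"
      unfolding C3_def using l s xs by (intro model_comparable) auto
    have "BC1_bound k1 k2 l t = exp ((l - \<rho>) * t) * ((1 + t) / (1 + l * t) powr K * ((1 + l * (1 + t)) / (1 + l)) powr (K - 1))"
      by (simp add: BC1_bound_def BC1_rho_def K_def \<rho>_def)
    thus ?thesis
      using comparable_trans[OF c1 comparable_mult[OF c2 comparable_trans[OF c3 c4], folded eq1]] by simp
  qed
  thus ?thesis by (rule that)
qed

theorem proposition4p5:
  fixes k1 k2 :: real
  assumes "k1 > 0" and "k2 > 0"
  shows "\<exists>C1 C2 :: real. C1 > 0 \<and> C2 > 0 \<and>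
    (\<forall>l t :: real. l \<ge> 0 \<longrightarrow> t \<ge> 0 \<longrightarrow>
      BC1_phi k1 k2 (of_real l) t \<in> \<real> \<and>
      C1 * BC1_bound k1 k2 l t \<le> Re (BC1_phi k1 k2 (of_real l) t) \<and>
      Re (BC1_phi k1 k2 (of_real l) t) \<le> C2 * BC1_bound k1 k2 l t)"
proof -
  obtain C0 where C0: "\<And>l t. l \<ge> 0 \<Longrightarrow> t > 0 \<Longrightarrow> comparable C0 (Re (BC1_phi k1 k2 (of_real l) t)) (BC1_bound k1 k2 l t)"
    using BC1_comparable_pos[OF assms] by metis
  \<comment> \<open>The lower limit 1 covers \<open>t = 0\<close>, where both sides equal 1 and the
    comparison for \<open>t > 0\<close> does not apply.\<close>
  define C where "C = max 1 C0"
  have C: "C > 0" by (simp add: C_def)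
  have "comparable C (Re (BC1_phi k1 k2 (of_real l) t)) (BC1_bound k1 k2 l t)" if "l \<ge> 0" "t \<ge> 0" for l t
  proof (cases "t = 0")
    case True
    have "Re (BC1_phi k1 k2 (of_real l) t) = 1"
      using BC1_phi_eq[OF assms, of t l] True by (simp add: eval_fps_at_0)
    moreover have "BC1_bound k1 k2 l t = 1" using True that by (simp add: BC1_bound_def)
    ultimately show ?thesis by (simp add: comparable_def C_def)
  next
    case False
    with that show ?thesis by (intro comparable_weaken[OF C0]) (auto simp: C_def)
  qed
  moreover have "BC1_phi k1 k2 (of_real l) t \<in> \<real>" if "t \<ge> 0" for l t
    using BC1_phi_eq[OF assms that] by simp
  ultimately show ?thesis
    using C by (intro exI[of _ "1 / C"] exI[of _ C]) (auto simp: comparable_def field_simps)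
qed

end
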